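(* Let $\lambda$ be a partition with at most $n$ parts and $R:=R_\lambda$. Let $\mathcal{A}_R=S_n^{R\text{-}312}$ and $\mathcal{P}_\lambda=\{Y_\lambda(\pi):\pi\in\mathcal{A}_R\}$; let $\mathcal{B}_R$ be the set of $R$-rightmost clump deleting chains and $\mathcal{Q}_\lambda$ the set of gapless $\lambda$-keys; let $\mathcal{C}_R=UG_R(n)$ and $\mathcal{R}_\lambda=\{M_\lambda(\gamma):\gamma\in\mathcal{C}_R\}$. Then: (i) tableau portrayal $B\mapsto Y_\lambda(B)$ is a bijection from $\mathcal{B}_R$ to $\mathcal{Q}_\lambda$, and $\gamma\mapsto M_\lambda(\gamma)$ is a bijection from $\mathcal{C}_R$ to $\mathcal{R}_\lambda$. (ii) $\mathcal{P}_\lambda=\mathcal{Q}_\lambda$; the map $\pi\mapsto B$ (with $B_h=\{\pi_1,\dots,\pi_{q_h}\}$) restricted to $\mathcal{A}_R$ induces the identity map from $\mathcal{P}_\lambda$ to $\mathcal{Q}_\lambda$; so an $R$-permutation is $R$-312-avoiding if and only if its $\lambda$-key is gapless. (iii) If $\pi\in S_n^R$ is $R$-312-avoiding, then $M_\lambda(\Psi_R(\pi))=Y_\lambda(\pi)$. Consequently $\mathcal{P}_\lambda=\mathcal{R}_\lambda$ and $\Psi_R:\mathcal{A}_R\to\mathcal{C}_R$ induces the identity map from $\mathcal{P}_\lambda$ to $\mathcal{R}_\lambda$.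
   Context: Fix $n\ge1$; $[m]=\{1,\dots,m\}$, $(a,b]=\{a+1,\dots,b\}$; $\mathrm{rank}^d(Q)$ = $d$-th largest element of finite $Q\subset\mathbb{Z}$. Partition $\lambda=(\lambda_1\ge\cdots\ge\lambda_n\ge0)$; boxes $(j,i)$, $1\le j\le\lambda_1$, $1\le i\le\zeta_j=\#\{i:\lambda_i\ge j\}$. $R_\lambda=\{q_1<\cdots<q_r\}\subseteq[n-1]$ = column lengths less than $n$; $q_0=0$, $q_{r+1}=n$, $p_h=q_h-q_{h-1}$, carrels $(q_{h-1},q_h]$. $R$-tuples $\nu\in[n]^n$; $UI_R(n)$: tuples with $\nu_i\ge i$ strictly increasing on each carrel. $S_n^R$: permutations $\pi$ of $[n]$ strictly increasing on each carrel; $R$-312-containing if there exist $h\in[r-1]$, $a\le q_h<b\le q_{h+1}<c\le n$ with $\pi_b<\pi_c<\pi_a$, else $R$-312-avoiding ($S_n^{R\text{-}312}$). $\Psi_R(\pi)_i=\mathrm{rank}^{q_h-i+1}(\{\pi_1,\dots,\pi_{q_h}\})$ for $i\in(q_{h-1},q_h]$. Gapless $R$-tuple: $\gamma\in UI_R(n)$ such that for each $h\in[r]$ with $\gamma_{q_h}>\gamma_{q_h+1}$, $s=\gamma_{q_h}-\gamma_{q_h+1}+1\le p_{h+1}$ and $\gamma_{q_h+t}=\gamma_{q_h}-s+t$, $t=1,\dots,s$; set $UG_R(n)$. An $R$-chain is $\emptyset=B_0\subset B_1\subset\cdots\subset B_r\subset B_{r+1}=[n]$ with $|B_h|=q_h$.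 A clump of a set of integers is a maximal subset of consecutive integers. The chain is $R$-rightmost clump deleting if for each $h\in[r]$, writing $B_{h+1}=L_1\cup\cdots\cup L_f$ as its clumps in increasing order, there is $e\in[f]$ with $L_e\cup\cdots\cup L_f\supseteq B_{h+1}\setminus B_h\supseteq L_{e+1}\cup\cdots\cup L_f$. Tableaux: $T_j(i)\in[n]$ strictly increasing down columns, weakly along rows; $\mathcal{T}_\lambda$, ordered entrywise; $B(T_j)$ = set of entries of column $j$. For $Q\subseteq[n]$, $Y(Q)$ is the column with entries $Q$ increasing downward. The tableau portrayal $Y_\lambda(B)$ of an $R$-chain has columns left to right: $\lambda_n$ copies of $Y([n])$, then for $h=r,\dots,1$, $\lambda_{q_h}-\lambda_{q_{h+1}}$ copies of $Y(B_h)$; for $\pi\in S_n^R$ the $\lambda$-key $Y_\lambda(\pi)$ is the portrayal of $B_h=\{\pi_1,\dots,\pi_{q_h}\}$. A $\lambda$-key is $Y\in\mathcal{T}_\lambda$ with $B(Y_l)\supseteq B(Y_j)$ for $l\le j$. A $\lambda$-key $Y$ is gapless if for every $h\in[r-1]$: letting $b$ be the smallest value in the columns of length $q_{h+1}$ not appearing in the columns of length $q_h$, and $m$ the largest value in the columns of length $q_h$, if $b<m$ then every integer of $[b,m]$ appears in the columns of length $q_{h+1}$. For $\alpha\in UI_R(n)$, $M_\lambda(\alpha)$ is the entrywise maximum of $\{T\in\mathcal{T}_\lambda:T_{\lambda_i}(i)=\alpha_i\text{ for all }i\text{ with }\lambda_i\ge1\}$ (a nonempty set closed under entrywise max). *)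

theory Defs
  imports "HOL-Library.FuncSet" "HOL-Combinatorics.Permutations"
begin

text \<open>
  Tuples, tableaux and chains are encoded as extensional functions on their index sets,
  so that HOL equality coincides with equality of the mathematical objects.
  A set \<open>R \<subseteq> [n - 1]\<close> with \<open>r = card R\<close> elements gives
  \<open>q\<^sub>0 = 0 < q\<^sub>1 < \<dots> < q\<^sub>r < q\<^sub>r\<^sub>+\<^sub>1 = n\<close>.
\<close>

definition qval :: "nat \<Rightarrow> nat set \<Rightarrow> nat \<Rightarrow> nat" where
  "qval n R h = (0 # sorted_list_of_set R @ [n]) ! h"

definition pval :: "nat \<Rightarrow> nat set \<Rightarrow> nat \<Rightarrow> nat" where
  "pval n R h = qval n R h - qval n R (h - 1)"

definition carrel :: "nat \<Rightarrow> nat set \<Rightarrow> nat \<Rightarrow> nat set" where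
  "carrel n R h = {qval n R (h - 1)<..qval n R h}"

definition rank_desc :: "nat \<Rightarrow> 'a::linorder set \<Rightarrow> 'a" where
  "rank_desc d Q = rev (sorted_list_of_set Q) ! (d - 1)"

definition carrel_increasing :: "nat \<Rightarrow> nat set \<Rightarrow> (nat \<Rightarrow> nat) \<Rightarrow> bool" where
  "carrel_increasing n R f \<longleftrightarrow> (\<forall>h\<in>{1..card R + 1}. strict_mono_on (carrel n R h) f)"

definition UI :: "nat \<Rightarrow> nat set \<Rightarrow> (nat \<Rightarrow> nat) set" where
  "UI n R = {\<nu> \<in> {1..n} \<rightarrow>\<^sub>E {1..n}. (\<forall>i\<in>{1..n}. i \<le> \<nu> i) \<and> carrel_increasing n R \<nu>}"

text \<open>
  The subtraction \<open>\<gamma>(q\<^sub>h) - s\<close> does not truncate: \<open>\<gamma>(q\<^sub>h) - s = \<gamma>(q\<^sub>h + 1) - 1\<close> and \<open>\<gamma>\<close> has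
  positive values.
\<close>
definition UG :: "nat \<Rightarrow> nat set \<Rightarrow> (nat \<Rightarrow> nat) set" where
  "UG n R = {\<gamma> \<in> UI n R. \<forall>h\<in>{1..card R}.
     \<gamma> (qval n R h) > \<gamma> (qval n R h + 1) \<longrightarrow>
     (let s = \<gamma> (qval n R h) - \<gamma> (qval n R h + 1) + 1 in
        s \<le> pval n R (h + 1) \<and>
        (\<forall>t\<in>{1..s}. \<gamma> (qval n R h + t) = \<gamma> (qval n R h) - s + t))}"

definition R_perms :: "nat \<Rightarrow> nat set \<Rightarrow> (nat \<Rightarrow> nat) set" where
  "R_perms n R = {\<pi>. \<pi> permutes {1..n} \<and> carrel_increasing n R \<pi>}"

definition R_312_containing :: "nat \<Rightarrow> nat set \<Rightarrow> (nat \<Rightarrow> nat) \<Rightarrow> bool" where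
  "R_312_containing n R \<pi> \<longleftrightarrow>
     (\<exists>h\<in>{1..card R - 1}. \<exists>a b c.
        1 \<le> a \<and> a \<le> qval n R h \<and> qval n R h < b \<and> b \<le> qval n R (h + 1) \<and>
        qval n R (h + 1) < c \<and> c \<le> n \<and> \<pi> b < \<pi> c \<and> \<pi> c < \<pi> a)"

definition R_312_avoiding_perms :: "nat \<Rightarrow> nat set \<Rightarrow> (nat \<Rightarrow> nat) set" where
  "R_312_avoiding_perms n R = {\<pi> \<in> R_perms n R. \<not> R_312_containing n R \<pi>}"

definition Psi :: "nat \<Rightarrow> nat set \<Rightarrow> (nat \<Rightarrow> nat) \<Rightarrow> nat \<Rightarrow> nat" where
  "Psi n R \<pi> = (\<lambda>i\<in>{1..n}.
     let h = (THE h. h \<in> {1..card R + 1} \<and> i \<in> carrel n R h)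
     in rank_desc (qval n R h - i + 1) (\<pi> ` {1..qval n R h}))"

definition R_chains :: "nat \<Rightarrow> nat set \<Rightarrow> (nat \<Rightarrow> nat set) set" where
  "R_chains n R = {B \<in> {0..card R + 1} \<rightarrow>\<^sub>E Pow {1..n}.
     B 0 = {} \<and> B (card R + 1) = {1..n} \<and>
     (\<forall>h\<in>{0..card R}. B h \<subset> B (h + 1)) \<and>
     (\<forall>h\<in>{0..card R + 1}. card (B h) = qval n R h)}"

definition consecutive :: "nat set \<Rightarrow> bool" where
  "consecutive L \<longleftrightarrow> (\<exists>a b. a \<le> b \<and> L = {a..b})"

definition clumps :: "nat set \<Rightarrow> nat set set" where
  "clumps Q = {L. consecutive L \<and> L \<subseteq> Q \<and>
     (\<forall>L'. consecutive L' \<and> L \<subseteq> L' \<and> L' \<subseteq> Q \<longrightarrow> L' = L)}"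

definition clump_list :: "nat set \<Rightarrow> nat set list \<Rightarrow> bool" where
  "clump_list Q Ls \<longleftrightarrow>
     set Ls = clumps Q \<and> sorted_wrt (\<lambda>L L'. \<forall>x\<in>L. \<forall>y\<in>L'. x < y) Ls"

text \<open>
  With \<open>Ls = [L\<^sub>1, \<dots>, L\<^sub>f]\<close>, \<open>\<Union>(set (drop e Ls))\<close> is \<open>L\<^sub>e\<^sub>+\<^sub>1 \<union> \<dots> \<union> L\<^sub>f\<close>.
\<close>
definition rightmost_clump_deleting_chains :: "nat \<Rightarrow> nat set \<Rightarrow> (nat \<Rightarrow> nat set) set" where
  "rightmost_clump_deleting_chains n R = {B \<in> R_chains n R. \<forall>h\<in>{1..card R}.
     \<exists>Ls. clump_list (B (h + 1)) Ls \<and>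
       (\<exists>e\<in>{1..length Ls}.
          B (h + 1) - B h \<subseteq> \<Union>(set (drop (e - 1) Ls)) \<and>
          \<Union>(set (drop e Ls)) \<subseteq> B (h + 1) - B h)}"

definition perm_chain :: "nat \<Rightarrow> nat set \<Rightarrow> (nat \<Rightarrow> nat) \<Rightarrow> nat \<Rightarrow> nat set" where
  "perm_chain n R \<pi> = (\<lambda>h\<in>{0..card R + 1}. \<pi> ` {1..qval n R h})"

text \<open>A partition is given by its values \<open>lam 1, \<dots>, lam n\<close>; other values of \<open>lam\<close> are never used.\<close>
definition is_partition :: "nat \<Rightarrow> (nat \<Rightarrow> nat) \<Rightarrow> bool" where
  "is_partition n lam \<longleftrightarrow> (\<forall>i\<in>{1..n}. \<forall>k\<in>{1..n}. i \<le> k \<longrightarrow> lam k \<le> lam i)"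

definition col_len :: "nat \<Rightarrow> (nat \<Rightarrow> nat) \<Rightarrow> nat \<Rightarrow> nat" where
  "col_len n lam j = card {i \<in> {1..n}. j \<le> lam i}"

definition R_of :: "nat \<Rightarrow> (nat \<Rightarrow> nat) \<Rightarrow> nat set" where
  "R_of n lam = {col_len n lam j | j. j \<in> {1..lam 1} \<and> col_len n lam j < n}"

text \<open>The box \<open>(j, i)\<close> lies in column \<open>j\<close> and row \<open>i\<close>.\<close>
definition boxes :: "nat \<Rightarrow> (nat \<Rightarrow> nat) \<Rightarrow> (nat \<times> nat) set" where
  "boxes n lam = (SIGMA j:{1..lam 1}. {1..col_len n lam j})"

definition tableaux :: "nat \<Rightarrow> (nat \<Rightarrow> nat) \<Rightarrow> (nat \<times> nat \<Rightarrow> nat) set" where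
  "tableaux n lam = {T \<in> boxes n lam \<rightarrow>\<^sub>E {1..n}.
     (\<forall>j i k. (j, i) \<in> boxes n lam \<and> (j, k) \<in> boxes n lam \<and> i < k \<longrightarrow> T (j, i) < T (j, k)) \<and>
     (\<forall>j l i. (j, i) \<in> boxes n lam \<and> (l, i) \<in> boxes n lam \<and> j \<le> l \<longrightarrow> T (j, i) \<le> T (l, i))}"

definition col_set :: "nat \<Rightarrow> (nat \<Rightarrow> nat) \<Rightarrow> (nat \<times> nat \<Rightarrow> nat) \<Rightarrow> nat \<Rightarrow> nat set" where
  "col_set n lam T j = {T (j, i) | i. i \<in> {1..col_len n lam j}}"

definition portrayal_columns :: "nat \<Rightarrow> (nat \<Rightarrow> nat) \<Rightarrow> (nat \<Rightarrow> nat set) \<Rightarrow> nat set list" where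
  "portrayal_columns n lam B = (let R = R_of n lam; q = qval n R in
     replicate (lam n) {1..n} @
     concat (map (\<lambda>h. replicate (lam (q h) - lam (q (h + 1))) (B h)) (rev [1..<card R + 1])))"

definition portrayal :: "nat \<Rightarrow> (nat \<Rightarrow> nat) \<Rightarrow> (nat \<Rightarrow> nat set) \<Rightarrow> nat \<times> nat \<Rightarrow> nat" where
  "portrayal n lam B = (\<lambda>(j, i)\<in>boxes n lam.
     sorted_list_of_set (portrayal_columns n lam B ! (j - 1)) ! (i - 1))"

definition key_of :: "nat \<Rightarrow> (nat \<Rightarrow> nat) \<Rightarrow> (nat \<Rightarrow> nat) \<Rightarrow> nat \<times> nat \<Rightarrow> nat" where
  "key_of n lam \<pi> = portrayal n lam (perm_chain n (R_of n lam) \<pi>)"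

definition lam_keys :: "nat \<Rightarrow> (nat \<Rightarrow> nat) \<Rightarrow> (nat \<times> nat \<Rightarrow> nat) set" where
  "lam_keys n lam = {Y \<in> tableaux n lam. \<forall>l\<in>{1..lam 1}. \<forall>j\<in>{1..lam 1}.
     l \<le> j \<longrightarrow> col_set n lam Y j \<subseteq> col_set n lam Y l}"

definition values_in_cols_of_length ::
    "nat \<Rightarrow> (nat \<Rightarrow> nat) \<Rightarrow> (nat \<times> nat \<Rightarrow> nat) \<Rightarrow> nat \<Rightarrow> nat set" where
  "values_in_cols_of_length n lam Y d =
     \<Union>(col_set n lam Y ` {j \<in> {1..lam 1}. col_len n lam j = d})"

definition gapless_keys :: "nat \<Rightarrow> (nat \<Rightarrow> nat) \<Rightarrow> (nat \<times> nat \<Rightarrow> nat) set" where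
  "gapless_keys n lam = {Y \<in> lam_keys n lam.
     let R = R_of n lam; q = qval n R; V = values_in_cols_of_length n lam Y in
     \<forall>h\<in>{1..card R - 1}.
       let b = Min (V (q (h + 1)) - V (q h)); m = Max (V (q h)) in
         b < m \<longrightarrow> {b..m} \<subseteq> V (q (h + 1))}"

definition tableaux_with_row_ends ::
    "nat \<Rightarrow> (nat \<Rightarrow> nat) \<Rightarrow> (nat \<Rightarrow> nat) \<Rightarrow> (nat \<times> nat \<Rightarrow> nat) set" where
  "tableaux_with_row_ends n lam \<alpha> =
     {T \<in> tableaux n lam. \<forall>i\<in>{1..n}. lam i \<ge> 1 \<longrightarrow> T (lam i, i) = \<alpha> i}"

definition row_end_max :: "nat \<Rightarrow> (nat \<Rightarrow> nat) \<Rightarrow> (nat \<Rightarrow> nat) \<Rightarrow> nat \<times> nat \<Rightarrow> nat" where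
  "row_end_max n lam \<alpha> =
     (\<lambda>x\<in>boxes n lam. Max {T x | T. T \<in> tableaux_with_row_ends n lam \<alpha>})"

text \<open>
  If \<open>P\<close> and \<open>Q\<close> are parametrized by \<open>f\<close> on \<open>A\<close> and by \<open>g\<close> on \<open>B\<close>, a map \<open>\<phi>\<close> from \<open>A\<close> to \<open>B\<close>
  induces \<open>F\<close> from \<open>P\<close> to \<open>Q\<close> if the square commutes; \<open>F\<close> is then determined on \<open>P\<close>.
\<close>
definition induces ::
    "('a \<Rightarrow> 'b) \<Rightarrow> 'a set \<Rightarrow> 'b set \<Rightarrow> ('a \<Rightarrow> 'p) \<Rightarrow> 'p set \<Rightarrow> ('b \<Rightarrow> 'q) \<Rightarrow> 'q set \<Rightarrow> ('p \<Rightarrow> 'q) \<Rightarrow> bool" where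
  "induces \<phi> A B f P g Q F \<longleftrightarrow>
     \<phi> \<in> A \<rightarrow> B \<and> f ` A = P \<and> g ` B = Q \<and> F \<in> P \<rightarrow> Q \<and> (\<forall>a\<in>A. F (f a) = g (\<phi> a))"

end

theory Submission imports Defs begin

text \<open>
  All objects are compared with \<open>R\<close>-chains. Call a step \<open>B \<subset> B'\<close> of a chain gapless if every integer
  between a new element \<open>x \<in> B' - B\<close> and a larger old element \<open>y \<in> B\<close> lies in \<open>B'\<close>. This one
  condition is equivalent to rightmost clump deletion, to \<open>R\<close>-312-avoidance of the permutation
  and to gaplessness of the key, and the last step of a chain always satisfies it.

  Since \<open>card (B h) = q h\<close>, the tuple \<open>\<Psi>\<^sub>R\<close> reads off the \<open>i\<close>-th least element of \<open>B h\<close> for \<open>i\<close> in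
  carrel \<open>h\<close>. These are exactly the row ends of the key, and the gapless condition forces the key
  to be the largest tableau with these row ends. Conversely a gapless tuple is realised by a gapless
  chain that is built from the bottom up: the elements missing from \<open>B (h + 1)\<close> are inserted directly
  below the first tuple value of the new carrel.
\<close>

section \<open>Ranked elements of finite sets\<close>

text \<open>Ranks start at 1 with the least element, so \<open>kth_least Q i\<close> is the entry in
  row i of the column Y(Q).\<close>

definition kth_least :: "nat set \<Rightarrow> nat \<Rightarrow> nat" where
  "kth_least Q i = sorted_list_of_set Q ! (i - 1)"

lemma card_less_strict_mono:
  fixes Q :: "nat set"
  assumes "finite Q" "x \<in> Q" "x < y"
  shows "card {z \<in> Q. z < x} < card {z \<in> Q. z < y}"
proof (rule psubset_card_mono)
  show "finite {z \<in> Q. z < y}" using assms by simp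
  have "x \<in> {z \<in> Q. z < y} - {z \<in> Q. z < x}" using assms by simp
  moreover have "{z \<in> Q. z < x} \<subseteq> {z \<in> Q. z < y}" using assms by auto
  ultimately show "{z \<in> Q. z < x} \<subset> {z \<in> Q. z < y}" by blast
qed

lemma kth_least_mem:
  assumes "finite Q" "1 \<le> i" "i \<le> card Q"
  shows "kth_least Q i \<in> Q"
proof -
  have "sorted_list_of_set Q ! (i - 1) \<in> set (sorted_list_of_set Q)"
    using assms by (intro nth_mem) auto
  then show ?thesis using assms by (simp add: kth_least_def)
qed

lemma kth_least_less:
  assumes "1 \<le> i" "i < k" "k \<le> card Q"
  shows "kth_least Q i < kth_least Q k"
  unfolding kth_least_def using assms
  by (intro sorted_wrt_nth_less[where P = "(<)"]) auto

lemma kth_least_surj: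
  assumes "finite Q" "x \<in> Q"
  obtains i where "1 \<le> i" "i \<le> card Q" "kth_least Q i = x"
proof -
  have "x \<in> set (sorted_list_of_set Q)" using assms by simp
  then obtain m where "m < card Q" "sorted_list_of_set Q ! m = x"
    unfolding in_set_conv_nth by auto
  then show ?thesis by (intro that[of "m + 1"]) (auto simp: kth_least_def)
qed

text \<open>Turns ranks into counts: the elements below the i-th one are the images of the smaller
  indices. Most later arguments about ranks compare such counts.\<close>

lemma card_less_kth_least:
  assumes "finite Q" "1 \<le> i" "i \<le> card Q"
  shows "card {y \<in> Q. y < kth_least Q i} = i - 1"
proof -
  have "{y \<in> Q. y < kth_least Q i} = kth_least Q ` {1..<i}"
  proof
    show "kth_least Q ` {1..<i} \<subseteq> {y \<in> Q. y < kth_least Q i}"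
      using assms by (auto intro!: kth_least_mem kth_least_less)
    show "{y \<in> Q. y < kth_least Q i} \<subseteq> kth_least Q ` {1..<i}"
    proof
      fix y assume y: "y \<in> {y \<in> Q. y < kth_least Q i}"
      then obtain k where k: "1 \<le> k" "k \<le> card Q" "kth_least Q k = y"
        using assms kth_least_surj by blast
      have "k < i"
      proof (rule ccontr)
        assume "\<not> k < i"
        then have "kth_least Q i \<le> kth_least Q k"
          using kth_least_less[of i k Q] assms k by (cases "i = k") auto
        then show False using y k by simp
      qed
      then show "y \<in> kth_least Q ` {1..<i}" using k by auto
    qed
  qed
  moreover have "inj_on (kth_least Q) {1..<i}"
  proof (rule linorder_inj_onI')
    fix a b assume "a \<in> {1..<i}" "b \<in> {1..<i}" "a < b"
    then show "kth_least Q a \<noteq> kth_least Q b" using kth_least_less[of a b Q] assms by auto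
  qed
  ultimately show ?thesis by (simp add: card_image)
qed

lemma kth_least_eqI:
  assumes "finite Q" "x \<in> Q" "card {y \<in> Q. y < x} = i - 1" "1 \<le> i"
  shows "kth_least Q i = x"
proof -
  obtain k where k: "1 \<le> k" "k \<le> card Q" "kth_least Q k = x"
    using assms kth_least_surj by blast
  then have "k - 1 = i - 1" using card_less_kth_least[of Q k] assms by simp
  then show ?thesis using k assms by (metis le_add_diff_inverse)
qed

lemma kth_least_image:
  assumes "strict_mono_on {1..m} f" "1 \<le> i" "i \<le> m"
  shows "kth_least (f ` {1..m}) i = f i"
proof (rule kth_least_eqI)
  have "{y \<in> f ` {1..m}. y < f i} = f ` {1..<i}"
    using assms strict_mono_on_less[OF assms(1)] by (auto simp: image_iff)
  moreover have "inj_on f {1..<i}"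
    using strict_mono_on_imp_inj_on[OF assms(1)] by (rule inj_on_subset) (use assms in auto)
  ultimately show "card {y \<in> f ` {1..m}. y < f i} = i - 1" by (simp add: card_image)
qed (use assms in auto)

text \<open>A superset has at least as many elements below any given value, so the element of a
  fixed rank can only move down. This makes the rows of a portrayal weakly increasing, since its
  columns shrink to the right.\<close>

lemma kth_least_antimono:
  assumes "finite B" "A \<subseteq> B" "1 \<le> i" "i \<le> card A"
  shows "kth_least B i \<le> kth_least A i"
proof (rule ccontr)
  assume "\<not> ?thesis"
  then have less: "kth_least A i < kth_least B i" by simp
  have A: "finite A" "card A \<le> card B" using assms by (auto intro: finite_subset card_mono)
  have "i - 1 = card {y \<in> A. y < kth_least A i}" using card_less_kth_least A assms by simp
  also have "\<dots> < card {y \<in> A. y < kth_least B i}"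
    using card_less_strict_mono kth_least_mem A assms less by simp
  also have "\<dots> \<le> card {y \<in> B. y < kth_least B i}"
    using assms by (intro card_mono) auto
  also have "\<dots> = i - 1" using card_less_kth_least A assms by simp
  finally show False by simp
qed

lemma le_kth_least_card:
  assumes "finite Q" "y \<in> Q"
  shows "y \<le> kth_least Q (card Q)"
proof -
  obtain i where i: "1 \<le> i" "i \<le> card Q" "kth_least Q i = y"
    using assms kth_least_surj by blast
  then show ?thesis using kth_least_less[of i "card Q" Q] by (cases "i = card Q") auto
qed

text \<open>The i-th least element has i - 1 positive integers of the set below it. This gives the
  condition \<open>i \<le> \<nu> i\<close> of \<open>UI\<close>.\<close>

lemma le_kth_least:
  assumes "Q \<subseteq> {1..n}" "1 \<le> i" "i \<le> card Q"
  shows "i \<le> kth_least Q i"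
proof -
  have fin: "finite Q" using assms finite_subset by blast
  have "i - 1 = card {y \<in> Q. y < kth_least Q i}" using card_less_kth_least fin assms by simp
  also have "\<dots> \<le> card {1..<kth_least Q i}" using assms by (intro card_mono) auto
  finally have "i - 1 \<le> kth_least Q i - 1" by simp
  moreover have "1 \<le> kth_least Q i" using assms kth_least_mem[OF fin assms(2,3)] by auto
  ultimately show ?thesis by simp
qed

text \<open>Along a run of consecutive members ranks and values grow in step: the elements below
  \<open>kth_least Q i + t\<close> are those below \<open>kth_least Q i\<close> and the first t
  members of the run.\<close>

lemma kth_least_consecutive:
  assumes "finite Q" "1 \<le> i" "i \<le> card Q" "{kth_least Q i..kth_least Q i + t} \<subseteq> Q"
  shows "i + t \<le> card Q" "kth_least Q (i + t) = kth_least Q i + t"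
proof -
  have "{y \<in> Q. y < kth_least Q i + t} =
      {y \<in> Q. y < kth_least Q i} \<union> {kth_least Q i..<kth_least Q i + t}"
    using assms(4) by auto
  moreover have "card \<dots> = card {y \<in> Q. y < kth_least Q i} + t"
    using assms(1) by (subst card_Un_disjoint) auto
  ultimately have count: "card {y \<in> Q. y < kth_least Q i + t} = i + t - 1"
    using card_less_kth_least assms by simp
  have "kth_least Q i + t \<in> Q" using assms by auto
  then obtain k where k: "1 \<le> k" "k \<le> card Q" "kth_least Q k = kth_least Q i + t"
    using assms kth_least_surj by blast
  then have "k - 1 = i + t - 1" using count card_less_kth_least[of Q k] assms by simp
  then have "k = i + t" using k assms by simp
  then show "i + t \<le> card Q" "kth_least Q (i + t) = kth_least Q i + t" using k by auto
qed

lemma rank_desc_kth_least: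
  assumes "finite Q" "1 \<le> i" "i \<le> card Q"
  shows "rank_desc (card Q - i + 1) Q = kth_least Q i"
  using assms by (simp add: rank_desc_def kth_least_def rev_nth)

section \<open>Gapless steps and clumps\<close>

text \<open>Quantifying over all new and old elements, instead of naming a minimum and a maximum,
  also covers a step from the empty set, which is then gapless.\<close>

definition gapless_step :: "nat set \<Rightarrow> nat set \<Rightarrow> bool" where
  "gapless_step B B' \<longleftrightarrow> (\<forall>x\<in>B' - B. \<forall>y\<in>B. \<forall>z. x < z \<and> z < y \<longrightarrow> z \<in> B')"

text \<open>The least new and the greatest old element span the widest of the intervals in question.
  Both ends lie in \<open>B'\<close>, so open and closed intervals give the same condition.\<close>

lemma gapless_step_iff_Min_Max:
  assumes "finite B'" "B \<subset> B'" "B \<noteq> {}"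
  shows "gapless_step B B' \<longleftrightarrow>
    (Min (B' - B) < Max B \<longrightarrow> {Min (B' - B)..Max B} \<subseteq> B')"
proof
  have fin: "finite B" "finite (B' - B)" "B' - B \<noteq> {}"
    using assms finite_subset by auto
  note mem = Min_in[OF fin(2,3)] Max_in[OF fin(1) assms(3)]
  show "Min (B' - B) < Max B \<longrightarrow> {Min (B' - B)..Max B} \<subseteq> B'" if "gapless_step B B'"
  proof (intro impI subsetI)
    fix z assume "z \<in> {Min (B' - B)..Max B}"
    then show "z \<in> B'" using that mem assms(2) unfolding gapless_step_def
      by (metis DiffD1 atLeastAtMost_iff in_mono order_le_imp_less_or_eq psubset_imp_subset)
  qed
  show "gapless_step B B'" if "Min (B' - B) < Max B \<longrightarrow> {Min (B' - B)..Max B} \<subseteq> B'"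
    unfolding gapless_step_def
  proof (intro ballI allI impI)
    fix x y z assume *: "x \<in> B' - B" "y \<in> B" "x < z \<and> z < y"
    then have "Min (B' - B) \<le> x" "y \<le> Max B" using fin by auto
    then show "z \<in> B'" using that * by (auto simp: subset_iff)
  qed
qed

section \<open>Clumps of a finite set of integers\<close>

lemma mem_clump_if_connected:
  assumes L: "L \<in> clumps Q" and "x \<in> L" "{x..y} \<subseteq> Q" "x \<le> y"
  shows "y \<in> L"
proof -
  from L obtain a b where ab: "a \<le> b" "L = {a..b}" "L \<subseteq> Q"
    by (auto simp: clumps_def consecutive_def)
  then have "L \<union> {x..y} = {a..max b y}" using assms by (auto simp: max_def)
  then have "consecutive (L \<union> {x..y})" using ab unfolding consecutive_def
    by (metis max.coboundedI1)
  then have "L \<union> {x..y} = L" using L ab assms by (auto simp: clumps_def)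
  then show ?thesis using assms by auto
qed

lemma clump_cover:
  assumes "finite Q" "x \<in> Q"
  obtains L where "L \<in> clumps Q" "x \<in> L"
proof -
  let ?F = "{L. consecutive L \<and> L \<subseteq> Q}"
  have "finite ?F" using assms by (auto intro: finite_subset[of _ "Pow Q"])
  moreover have "{x} \<in> ?F" using assms
    by (auto simp: consecutive_def intro!: exI[of _ x])
  ultimately obtain L where L: "L \<in> ?F" "{x} \<subseteq> L" "\<forall>L'\<in>?F. L \<subseteq> L' \<longrightarrow> L = L'"
    using finite_has_maximal2[of ?F "{x}"] by auto
  then have "L \<in> clumps Q" unfolding clumps_def by blast
  then show ?thesis using that L by auto
qed

lemma clumps_eqI:
  assumes L: "L \<in> clumps Q" "L' \<in> clumps Q" and "x \<in> L" "x \<in> L'"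
  shows "L = L'"
proof -
  obtain a b c d where ab: "L = {a..b}" "L' = {c..d}" "L \<subseteq> Q" "L' \<subseteq> Q"
    using L by (auto simp: clumps_def consecutive_def)
  then have x: "a \<le> x" "x \<le> b" "c \<le> x" "x \<le> d" using assms by auto
  then have "L \<union> L' = {min a c..max b d}" using ab by auto
  moreover have "min a c \<le> max b d" using x by linarith
  ultimately have "consecutive (L \<union> L')" unfolding consecutive_def by blast
  then have "L \<union> L' = L" "L \<union> L' = L'" using L ab by (auto simp: clumps_def)
  then show ?thesis by simp
qed

text \<open>One comparison decides the order of two clumps: if some element of \<open>L'\<close> did
  not exceed some element of \<open>L\<close>, the two intervals would cover everything from
  \<open>x\<close> to \<open>y\<close>, and maximality would put \<open>y\<close> into
  \<open>L\<close>.\<close>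

lemma clumps_separated:
  assumes L: "L \<in> clumps Q" "L' \<in> clumps Q" and "x \<in> L" "y \<in> L'" "y \<notin> L" "x < y"
    and uv: "u \<in> L" "v \<in> L'"
  shows "u < v"
proof -
  obtain a b c d where ab: "L = {a..b}" "L' = {c..d}" "L \<subseteq> Q" "L' \<subseteq> Q"
    using L by (auto simp: clumps_def consecutive_def)
  show ?thesis
  proof (rule ccontr)
    assume "\<not> u < v"
    then have "c \<le> b" using uv ab by auto
    then have "{x..y} \<subseteq> L \<union> L'" using assms ab by auto
    then show False using mem_clump_if_connected[OF L(1), of x y] assms ab by auto
  qed
qed

text \<open>Clumps are disjoint, hence determined by their minima, and sorting the minima sorts the
  clumps.\<close>

lemma clump_list_exists:
  assumes "finite Q"
  obtains Ls where "clump_list Q Ls"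
proof -
  have ne: "L \<noteq> {}" "finite L" "Min L \<in> L" if "L \<in> clumps Q" for L
    using that by (auto simp: clumps_def consecutive_def)
  have fin: "finite (clumps Q)"
    using assms by (auto simp: clumps_def intro: finite_subset[of _ "Pow Q"])
  have inj: "inj_on Min (clumps Q)"
    using clumps_eqI ne by (metis inj_onI)
  let ?f = "inv_into (clumps Q) Min"
  let ?Ls = "map ?f (sorted_list_of_set (Min ` clumps Q))"
  have "set ?Ls = clumps Q" using inj fin by (simp add: inv_into_image_cancel)
  moreover have "sorted_wrt (\<lambda>L L'. \<forall>x\<in>L. \<forall>y\<in>L'. x < y) ?Ls"
    unfolding sorted_wrt_map
  proof (rule sorted_wrt_mono_rel[OF _ strict_sorted_list_of_set])
    fix a b assume "a \<in> set (sorted_list_of_set (Min ` clumps Q))"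
      "b \<in> set (sorted_list_of_set (Min ` clumps Q))" and less: "a < b"
    then obtain L L' where L: "L \<in> clumps Q" "a = Min L" "L' \<in> clumps Q" "b = Min L'"
      using fin by auto
    have "Min L' \<notin> L" using clumps_eqI[OF L(1,3)] ne[OF L(3)] less L
      by (metis less_irrefl)
    then have "\<forall>x\<in>L. \<forall>y\<in>L'. x < y"
      using clumps_separated[OF L(1,3)] ne[OF L(1)] ne[OF L(3)] less L by metis
    then show "\<forall>x\<in>?f a. \<forall>y\<in>?f b. x < y" using L inj by simp
  qed
  ultimately show ?thesis using that unfolding clump_list_def by blast
qed

text \<open>In a strictly ordered list of sets an element occurs at only one position, so membership
  in the union of a suffix is a comparison of indices.\<close>

lemma mem_Union_drop_iff:
  assumes "x \<in> Ls ! i" "i < length Ls" and sorted: "sorted_wrt (\<lambda>L L'. \<forall>x\<in>L. \<forall>y\<in>L'. x < y) Ls"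
  shows "(x::nat) \<in> \<Union>(set (drop e Ls)) \<longleftrightarrow> e \<le> i"
proof
  assume "x \<in> \<Union>(set (drop e Ls))"
  then obtain k where k: "x \<in> Ls ! (e + k)" "e + k < length Ls"
    by (auto simp: in_set_conv_nth)
  show "e \<le> i"
  proof (rule ccontr)
    assume "\<not> e \<le> i"
    then have "\<forall>x\<in>Ls ! i. \<forall>y\<in>Ls ! (e + k). x < y"
      using sorted_wrt_nth_less[OF sorted, of i "e + k"] k by simp
    then show False using k assms by auto
  qed
next
  assume "e \<le> i"
  then have "Ls ! i \<in> set (drop e Ls)"
    using assms by (auto simp: in_set_conv_nth intro!: exI[of _ "i - e"])
  then show "x \<in> \<Union>(set (drop e Ls))" using assms by auto
qed

text \<open>The clump \<open>L\<^sub>e\<close> is the one containing the least new element. Every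
  new element lies in it or further right, and an old element further right would, by gaplessness,
  be joined to the least new one inside \<open>B'\<close> and hence share its clump. Conversely, a
  new \<open>x\<close> has index at least e and an old \<open>y\<close> index at most e, so
  \<open>x < y\<close> forces both into \<open>L\<^sub>e\<close>, which contains all integers
  between them.\<close>

lemma gapless_step_iff_clumps:
  assumes fin: "finite B'" and sub: "B \<subset> B'"
  shows "gapless_step B B' \<longleftrightarrow>
    (\<exists>Ls. clump_list B' Ls \<and>
       (\<exists>e\<in>{1..length Ls}. B' - B \<subseteq> \<Union>(set (drop (e - 1) Ls)) \<and> \<Union>(set (drop e Ls)) \<subseteq> B' - B))"
    (is "_ \<longleftrightarrow> ?rhs")
proof
  have index: "\<exists>i < length Ls. x \<in> Ls ! i" if "clump_list B' Ls" "x \<in> B'" for x Ls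
    using that clump_cover[OF fin, of x] unfolding clump_list_def by (metis in_set_conv_nth)
  assume gap: "gapless_step B B'"
  obtain Ls where Ls: "clump_list B' Ls" using clump_list_exists[OF fin] by blast
  then have sorted: "sorted_wrt (\<lambda>L L'. \<forall>x\<in>L. \<forall>y\<in>L'. x < y) Ls" by (simp add: clump_list_def)
  let ?D = "B' - B"
  let ?x = "Min ?D"
  have x: "?x \<in> ?D" using fin sub by (intro Min_in) auto
  then obtain i where i: "i < length Ls" "?x \<in> Ls ! i" using index Ls by blast
  have "?D \<subseteq> \<Union>(set (drop i Ls))"
  proof
    fix d assume d: "d \<in> ?D"
    then obtain k where k: "k < length Ls" "d \<in> Ls ! k" using index Ls by blast
    have "i \<le> k"
    proof (rule ccontr)
      assume "\<not> i \<le> k"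
      then have "d < ?x" using sorted_wrt_nth_less[OF sorted, of k i] k i by simp
      then show False using d fin by (simp add: leD)
    qed
    then show "d \<in> \<Union>(set (drop i Ls))" using mem_Union_drop_iff[OF k(2,1) sorted] by simp
  qed
  moreover have "\<Union>(set (drop (Suc i) Ls)) \<subseteq> ?D"
  proof
    fix y assume "y \<in> \<Union>(set (drop (Suc i) Ls))"
    then obtain k where k: "y \<in> Ls ! (Suc i + k)" "Suc i + k < length Ls"
      by (auto simp: in_set_conv_nth)
    then have clump: "Ls ! (Suc i + k) \<in> clumps B'" "Ls ! i \<in> clumps B'"
      using Ls i nth_mem unfolding clump_list_def by blast+
    then have y: "y \<in> B'" using k by (auto simp: clumps_def)
    have sep: "\<forall>x\<in>Ls ! i. \<forall>y\<in>Ls ! (Suc i + k). x < y"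
      using sorted_wrt_nth_less[OF sorted, of i "Suc i + k"] k by simp
    then have less: "?x < y" using k i by blast
    show "y \<in> ?D"
    proof (rule ccontr)
      assume "y \<notin> ?D"
      then have "\<forall>z. ?x < z \<and> z < y \<longrightarrow> z \<in> B'" using gap x y unfolding gapless_step_def by blast
      then have "{?x..y} \<subseteq> B'" using x y
        by (metis DiffD1 atLeastAtMost_iff order_le_imp_less_or_eq subsetI)
      then have "y \<in> Ls ! i" using mem_clump_if_connected[OF clump(2) i(2)] less by simp
      then show False using sep k by blast
    qed
  qed
  \<comment> \<open>List positions start at 0 and e starts at 1, hence the witness
    \<open>Suc i\<close> for the clump at position \<open>i\<close>.\<close>
  ultimately show ?rhs using Ls i
    by (intro exI[of _ Ls] conjI bexI[of _ "Suc i"]) auto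
next
  have index: "\<exists>i < length Ls. x \<in> Ls ! i" if "clump_list B' Ls" "x \<in> B'" for x Ls
    using that clump_cover[OF fin, of x] unfolding clump_list_def by (metis in_set_conv_nth)
  assume ?rhs
  then obtain Ls e where Ls: "clump_list B' Ls" "1 \<le> e" "e \<le> length Ls"
    "B' - B \<subseteq> \<Union>(set (drop (e - 1) Ls))" "\<Union>(set (drop e Ls)) \<subseteq> B' - B"
    by auto
  then have sorted: "sorted_wrt (\<lambda>L L'. \<forall>x\<in>L. \<forall>y\<in>L'. x < y) Ls" by (simp add: clump_list_def)
  show "gapless_step B B'" unfolding gapless_step_def
  proof (intro ballI allI impI)
    fix x y z assume *: "x \<in> B' - B" "y \<in> B" "x < z \<and> z < y"
    obtain i where i: "i < length Ls" "x \<in> Ls ! i" using index Ls * by blast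
    obtain k where k: "k < length Ls" "y \<in> Ls ! k" using index Ls * sub by blast
    have "e - 1 \<le> i" using mem_Union_drop_iff[OF i(2,1) sorted] * Ls by blast
    moreover have "\<not> e \<le> k" using mem_Union_drop_iff[OF k(2,1) sorted] * Ls by blast
    moreover have "\<not> k < i" using sorted_wrt_nth_less[OF sorted, of k i] k i * by fastforce
    ultimately have "i = k" by simp
    moreover have "Ls ! i \<in> clumps B'" using Ls i nth_mem unfolding clump_list_def by blast
    ultimately show "z \<in> B'" using i k * by (auto simp: clumps_def consecutive_def)
  qed
qed

section \<open>Ranked elements across a gapless step\<close>

lemma gapless_step_above:
  assumes "finite B'" "B \<subset> B'" "gapless_step B B'" "y \<in> B" "kth_least B' (card B + 1) \<le> y"
  shows "{kth_least B' (card B + 1)..y} \<subseteq> B'"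
proof -
  let ?c = "kth_least B' (card B + 1)"
  have card: "card B < card B'" using assms psubset_card_mono by blast
  have fin: "finite B" using assms finite_subset by blast
  have c: "?c \<in> B'" using assms card by (intro kth_least_mem) auto
  \<comment> \<open>Pigeonhole: \<open>?c\<close> and the \<open>card B\<close> elements of
    \<open>B'\<close> below it cannot all lie in \<open>B\<close>.\<close>
  have "\<exists>x\<in>B' - B. x \<le> ?c"
  proof (rule ccontr)
    assume "\<not> ?thesis"
    then have "z \<in> B" if "z \<in> B'" "z \<le> ?c" for z using that by blast
    then have "insert ?c {y \<in> B'. y < ?c} \<subseteq> B" using c by auto
    then have "card (insert ?c {y \<in> B'. y < ?c}) \<le> card B" using fin card_mono by blast
    then show False using card_less_kth_least[of B' "card B + 1"] assms card by simp
  qed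
  then obtain x where x: "x \<in> B' - B" "x \<le> ?c" by blast
  show ?thesis
  proof
    fix z assume "z \<in> {?c..y}"
    then consider "z = ?c" | "z = y" | "x < z \<and> z < y" using x by force
    then show "z \<in> B'" using assms c x unfolding gapless_step_def by cases blast+
  qed
qed

text \<open>
  This is what makes the key of a gapless chain the largest tableau with its row ends: an entry \<open>a\<close>
  of a column of length \<open>card B'\<close> is bounded by its right neighbour in the column of \<open>B\<close>, and by the
  first entry below row \<open>card B\<close> of its own column.
\<close>
lemma le_kth_least_gapless:
  assumes "finite B'" "B \<subset> B'" "gapless_step B B'" "1 \<le> i" "i \<le> card B"
    and a: "a \<le> kth_least B i" "a + (card B + 1 - i) \<le> kth_least B' (card B + 1)"
  shows "a \<le> kth_least B' i"
proof (rule ccontr)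
  let ?b = "kth_least B' i" and ?c = "kth_least B' (card B + 1)" and ?m = "kth_least B (card B)"
  assume "\<not> ?thesis"
  then have less: "?b < kth_least B i" "?b < a" using a by auto
  have card: "card B < card B'" using assms psubset_card_mono by blast
  have fin: "finite B" using assms finite_subset by blast
  have b: "?b \<in> B'" using assms card by (intro kth_least_mem) auto
  have bc: "?b < ?c" using assms card by (intro kth_least_less) auto
  \<comment> \<open>Otherwise the i elements of \<open>B'\<close> up to \<open>?b\<close> would all
    be elements of \<open>B\<close> below its i-th one, and there are only i - 1 of those.\<close>
  have "\<exists>x\<in>B' - B. x \<le> ?b"
  proof (rule ccontr)
    assume "\<not> ?thesis"
    then have "z \<in> B" if "z \<in> B'" "z \<le> ?b" for z using that by blast
    then have "insert ?b {y \<in> B'. y < ?b} \<subseteq> {y \<in> B. y < kth_least B i}" using b less by auto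
    then have "card (insert ?b {y \<in> B'. y < ?b}) \<le> card {y \<in> B. y < kth_least B i}"
      using fin by (intro card_mono) auto
    then show False using card_less_kth_least[of B i] card_less_kth_least[of B' i] assms card fin
      by simp
  qed
  then obtain x where x: "x \<in> B' - B" "x \<le> ?b" by blast
  have m: "?m \<in> B" using assms fin by (intro kth_least_mem) auto
  have "kth_least B i \<le> ?m" using kth_least_mem[of B i] assms fin by (intro le_kth_least_card) auto
  then have bm: "?b < ?m" using less by simp
  \<comment> \<open>Otherwise \<open>B\<close> together with \<open>x\<close> would give
    \<open>card B + 1\<close> elements of \<open>B'\<close> below \<open>?c\<close>, one more than
    its rank allows.\<close>
  have "?c \<le> ?m"
  proof (rule ccontr)
    assume "\<not> ?thesis"
    then have "insert x B \<subseteq> {y \<in> B'. y < ?c}"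
      using x bc assms le_kth_least_card[OF fin] by fastforce
    then have "card (insert x B) \<le> card {y \<in> B'. y < ?c}" using assms by (intro card_mono) auto
    then show False using card_less_kth_least[of B' "card B + 1"] assms card fin x by simp
  qed
  have "{?b..?c} \<subseteq> B'"
  proof
    fix z assume "z \<in> {?b..?c}"
    then consider "z = ?b" | "z = ?m" | "x < z \<and> z < ?m" using x \<open>?c \<le> ?m\<close> by force
    then show "z \<in> B'" using assms b x m unfolding gapless_step_def by cases blast+
  qed
  then have k: "i + (?c - ?b) \<le> card B'" "kth_least B' (i + (?c - ?b)) = ?c"
    using kth_least_consecutive[of B' i "?c - ?b"] assms card bc by auto
  \<comment> \<open>The run from \<open>?b\<close> to \<open>?c\<close> has no gaps, so
    \<open>?c\<close> exceeds \<open>?b\<close> by exactly \<open>card B + 1 - i\<close>. As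
    \<open>a\<close> exceeds \<open>?b\<close>, this contradicts the second bound on
    \<open>a\<close>.\<close>
  have "i + (?c - ?b) = card B + 1"
    using card_less_kth_least[OF assms(1) _ k(1)] card_less_kth_least[of B' "card B + 1"]
      k(2) assms card by simp
  then show False using a less bc by linarith
qed

text \<open>The inductive step for building a chain from a tuple. The new set keeps \<open>B\<close>
  below a threshold \<open>x\<close>, contains all integers from \<open>x\<close> up to the first
  tuple value \<open>?c\<close>, and ends with the tuple values of the carrel; \<open>x\<close> is
  chosen so that exactly \<open>q\<close> elements precede \<open>?c\<close>.\<close>

lemma gapless_extension:
  assumes B: "B \<subseteq> {1..n}" "card B = q" and q: "q < q'"
    and mono: "strict_mono_on {q<..q'} \<gamma>"
    and upper: "\<forall>i\<in>{q<..q'}. i \<le> \<gamma> i \<and> \<gamma> i \<le> n"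
    and above: "\<forall>y\<in>B. \<gamma> (q + 1) \<le> y \<longrightarrow> {\<gamma> (q + 1)..y} \<subseteq> \<gamma> ` {q<..q'}"
  obtains B' where "B \<subseteq> B'" "B' \<subseteq> {1..n}" "card B' = q'"
    "\<forall>i\<in>{q<..q'}. kth_least B' i = \<gamma> i" "gapless_step B B'"
proof -
  let ?c = "\<gamma> (q + 1)"
  let ?f = "\<lambda>x. card {y \<in> B. y < x} + (?c - x)"
  let ?P = "\<lambda>x. 1 \<le> x \<and> ?f x \<le> q"
  have fin: "finite B" using B finite_subset by blast
  have c: "q + 1 \<le> ?c" "?c \<le> n" using upper q by auto
  have "card {y \<in> B. y < ?c} \<le> card B" using fin by (intro card_mono) auto
  then have Pc: "?P ?c" using c B by simp
  \<comment> \<open>\<open>?f x\<close> is the size of the part below \<open>?c\<close>. Lowering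
    \<open>x\<close> by one adds one integer and discards none, so \<open>?f\<close> grows by at
    most one; hence the least \<open>x\<close> with \<open>?f x \<le> q\<close> attains
    \<open>q\<close>. At the extreme \<open>x = 1\<close> this holds because \<open>?c - 1\<close>
    is already at least \<open>q\<close>.\<close>
  define x where "x = (LEAST x. ?P x)"
  have x: "?P x" "x \<le> ?c" unfolding x_def using LeastI[of ?P, OF Pc] Least_le[of ?P, OF Pc] by auto
  have "q \<le> ?f x"
  proof (cases "x = 1")
    case True
    then show ?thesis using c by simp
  next
    case False
    then have "\<not> ?P (x - 1)" using not_less_Least[of "x - 1" ?P] x unfolding x_def by auto
    moreover have "1 \<le> x - 1" using False x by linarith
    ultimately have "q < ?f (x - 1)" by linarith
    also have "\<dots> \<le> ?f x + 1"
    proof -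
      have "card {y \<in> B. y < x - 1} \<le> card {y \<in> B. y < x}" using fin by (intro card_mono) auto
      then show ?thesis by simp
    qed
    finally show ?thesis by simp
  qed
  then have fx: "?f x = q" using x by simp
  have ge_c: "?c \<le> \<gamma> i" if "i \<in> {q<..q'}" for i
  proof -
    have "q + 1 \<in> {q<..q'}" "q + 1 \<le> i" using that by auto
    then show ?thesis using strict_mono_on_leD[OF mono _ that, of "q + 1"] by blast
  qed
  let ?low = "{y \<in> B. y < x} \<union> {x..<?c}"
  let ?B' = "?low \<union> \<gamma> ` {q<..q'}"
  have inj: "inj_on \<gamma> {q<..q'}" using strict_mono_on_imp_inj_on[OF mono] .
  have low: "finite ?low" "card ?low = q" "\<forall>y\<in>?low. y < ?c"
  proof -
    show "card ?low = q" using fin fx by (subst card_Un_disjoint) auto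
  qed (use fin x in auto)
  show ?thesis
  proof (rule that)
    \<comment> \<open>Old elements below \<open>x\<close> are kept, those in \<open>{x..<?c}\<close>
      are absorbed by the filled interval, and those from \<open>?c\<close> on are tuple values by
      \<open>above\<close>.\<close>
    have "y \<in> ?B'" if "y \<in> B" for y
      using that above[rule_format, OF that]
      by (cases "y < x"; cases "y < ?c") (auto simp del: atLeastatMost_subset_iff)
    then show "B \<subseteq> ?B'" by blast
    show "?B' \<subseteq> {1..n}" using B x c upper by force
    have disj: "?low \<inter> \<gamma> ` {q<..q'} = {}" using low(3) ge_c by fastforce
    then show "card ?B' = q'" using low inj q by (subst card_Un_disjoint) (auto simp: card_image)
    show "\<forall>i\<in>{q<..q'}. kth_least ?B' i = \<gamma> i"
    proof
      fix i assume i: "i \<in> {q<..q'}"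
      show "kth_least ?B' i = \<gamma> i"
      proof (rule kth_least_eqI)
        have "\<forall>k\<in>{q<..q'}. \<gamma> k < \<gamma> i \<longleftrightarrow> k < i"
          using strict_mono_on_less[OF mono] i by blast
        then have "{y \<in> \<gamma> ` {q<..q'}. y < \<gamma> i} = \<gamma> ` {q<..<i}" using i by auto
        moreover have "y < \<gamma> i" if "y \<in> ?low" for y
          using bspec[OF low(3) that] ge_c[OF i] by (rule less_le_trans)
        then have "{y \<in> ?low. y < \<gamma> i} = ?low" by blast
        moreover have "{y \<in> ?B'. y < \<gamma> i} =
            {y \<in> ?low. y < \<gamma> i} \<union> {y \<in> \<gamma> ` {q<..q'}. y < \<gamma> i}" by blast
        ultimately have "{y \<in> ?B'. y < \<gamma> i} = ?low \<union> \<gamma> ` {q<..<i}" by simp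
        also have "card \<dots> = q + (i - q - 1)"
        proof -
          have "?low \<inter> \<gamma> ` {q<..<i} = {}"
            using disj i by fastforce
          moreover have "inj_on \<gamma> {q<..<i}" using inj by (rule inj_on_subset) (use i in auto)
          ultimately show ?thesis using low by (subst card_Un_disjoint) (auto simp: card_image)
        qed
        finally show "card {y \<in> ?B'. y < \<gamma> i} = i - 1" using i by simp
      qed (use i low in auto)
    qed
    show "gapless_step B ?B'" unfolding gapless_step_def
    proof (intro ballI allI impI)
      fix u y z assume *: "u \<in> ?B' - B" "y \<in> B" "u < z \<and> z < y"
      \<comment> \<open>Below \<open>x\<close> the sets \<open>B\<close> and \<open>?B'\<close>
        agree, so a new element cannot lie there.\<close>
      have "x \<le> u" using * x ge_c by fastforce
      then have "x \<le> z" using * by simp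
      show "z \<in> ?B'"
      proof (cases "z < ?c")
        case True
        then show ?thesis using \<open>x \<le> z\<close> by simp
      next
        case False
        then have "z \<in> {?c..y}" "?c \<le> y" using * by auto
        then show ?thesis using above * by blast
      qed
    qed
  qed
qed

section \<open>Chains, permutations and tuples\<close>

text \<open>Chains, permutations and tuples depend on the partition only through \<open>R\<close>,
  so they are treated for any \<open>R\<close>; the partition enters later through a
  sublocale.\<close>

locale carrels =
  fixes n :: nat and R :: "nat set"
  assumes n_pos: "1 \<le> n" and R_sub: "R \<subseteq> {1..<n}"
begin

abbreviation "q \<equiv> qval n R"
abbreviation "r \<equiv> card R"

lemma finite_R: "finite R" using R_sub finite_subset by blast

lemma q_0 [simp]: "q 0 = 0" by (simp add: qval_def)

lemma q_last [simp]: "q (Suc r) = n" by (simp add: qval_def nth_append)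

lemma q_less: "h < k \<Longrightarrow> k \<le> r + 1 \<Longrightarrow> q h < q k"
  unfolding qval_def
proof (rule sorted_wrt_nth_less[where P = "(<)"])
  show "sorted_wrt (<) (0 # sorted_list_of_set R @ [n])"
    using R_sub finite_R n_pos by (auto simp: sorted_wrt_append)
qed auto

lemma q_le: "h \<le> k \<Longrightarrow> k \<le> r + 1 \<Longrightarrow> q h \<le> q k"
  using q_less[of h k] by (cases "h = k") auto

lemma q_le_n: "h \<le> r + 1 \<Longrightarrow> q h \<le> n"
  using q_le[of h "r + 1"] by simp

lemma q_image: "q ` {1..r} = R"
proof -
  have "q ` {1..r} = (\<lambda>h. q (Suc h)) ` {..<r}"
    unfolding image_image[symmetric] by (metis One_nat_def image_Suc_lessThan)
  also have "\<dots> = (\<lambda>h. sorted_list_of_set R ! h) ` {..<r}"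
    by (intro image_cong) (auto simp: qval_def nth_append)
  also have "\<dots> = set (sorted_list_of_set R)"
    by (auto simp: set_conv_nth)
  finally show ?thesis using finite_R by simp
qed

lemma mem_carrel_iff: "i \<in> carrel n R h \<longleftrightarrow> q (h - 1) < i \<and> i \<le> q h"
  by (auto simp: carrel_def)

lemma carrel_Suc: "carrel n R (Suc h) = {q h<..q (Suc h)}"
  by (simp add: carrel_def)

lemma carrel_cover:
  assumes "i \<in> {1..n}"
  obtains h where "h \<le> r" "i \<in> carrel n R (Suc h)"
proof -
  let ?k = "LEAST k. i \<le> q k"
  have last: "i \<le> q (Suc r)" using assms by simp
  then have k: "i \<le> q ?k" by (rule LeastI)
  have k': "?k \<le> Suc r" using last by (rule Least_le)
  have "?k \<noteq> 0"
  proof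
    assume "?k = 0"
    then show False using k assms by simp
  qed
  then obtain h where h: "?k = Suc h" using not0_implies_Suc by blast
  then have "\<not> i \<le> q h" using not_less_Least[of h "\<lambda>k. i \<le> q k"] by simp
  then show ?thesis using that[of h] h k k' by (simp add: carrel_Suc)
qed

lemma carrel_unique:
  assumes "h \<le> r" "k \<le> r" "i \<in> carrel n R (Suc h)" "i \<in> carrel n R (Suc k)"
  shows "h = k"
proof (cases h k rule: linorder_cases)
  case less
  then show ?thesis using q_le[of "Suc h" k] assms by (auto simp: carrel_Suc)
next
  case greater
  then show ?thesis using q_le[of "Suc k" h] assms by (auto simp: carrel_Suc)
qed

text \<open>Evaluates the definite description in \<open>Psi\<close> and \<open>chain_tuple\<close>.
  Carrels are indexed by \<open>Suc h\<close> with \<open>h \<le> r\<close> to avoid truncated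
  predecessors.\<close>

lemma carrel_THE:
  assumes "h \<le> r" "i \<in> carrel n R (Suc h)"
  shows "(THE h. h \<in> {1..r + 1} \<and> i \<in> carrel n R h) = Suc h"
proof (rule the_equality)
  fix k assume k: "k \<in> {1..r + 1} \<and> i \<in> carrel n R k"
  then have "k - 1 \<le> r" "i \<in> carrel n R (Suc (k - 1))" by auto
  then have "k - 1 = h" using carrel_unique assms by blast
  then show "k = Suc h" using k by auto
qed (use assms in auto)

lemma carrel_bounds: "h \<le> r \<Longrightarrow> i \<in> carrel n R (Suc h) \<Longrightarrow> 1 \<le> i \<and> i \<le> n"
  using q_le_n[of "Suc h"] by (auto simp: carrel_Suc)

lemma carrel_increasing_iff:
  "carrel_increasing n R f \<longleftrightarrow> (\<forall>h\<le>r. strict_mono_on (carrel n R (Suc h)) f)"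
proof -
  have "{1..r + 1} = Suc ` {..r}" by (simp add: atMost_atLeast0)
  then show ?thesis by (auto simp: carrel_increasing_def)
qed

context
  fixes B assumes B: "B \<in> R_chains n R"
begin

lemma chain_0: "B 0 = {}"
  and chain_last: "B (Suc r) = {1..n}"
  and chain_psubset: "h \<le> r \<Longrightarrow> B h \<subset> B (Suc h)"
  and chain_card: "h \<le> Suc r \<Longrightarrow> card (B h) = q h"
  and chain_sub: "h \<le> Suc r \<Longrightarrow> B h \<subseteq> {1..n}"
  using B unfolding R_chains_def by (force simp: PiE_iff)+

lemma chain_undefined: "Suc r < h \<Longrightarrow> B h = undefined"
  using B unfolding R_chains_def PiE_def extensional_def by simp

lemma chain_finite: "h \<le> Suc r \<Longrightarrow> finite (B h)"
  using chain_sub finite_subset by blast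

lemma chain_mono: "h \<le> k \<Longrightarrow> k \<le> Suc r \<Longrightarrow> B h \<subseteq> B k"
proof (induction k)
  case (Suc k)
  then show ?case using chain_psubset[of k] by (cases "h = Suc k") auto
qed simp

end

end

section \<open>Gapless chains\<close>

definition gapless_chains :: "nat \<Rightarrow> nat set \<Rightarrow> (nat \<Rightarrow> nat set) set" where
  "gapless_chains n R = {B \<in> R_chains n R. \<forall>h\<in>{1..card R}. gapless_step (B h) (B (h + 1))}"

text \<open>The chain counterpart of \<open>Psi\<close>, restricted to the same domain so that the
  two agree as functions and not only on [n].\<close>

definition chain_tuple :: "nat \<Rightarrow> nat set \<Rightarrow> (nat \<Rightarrow> nat set) \<Rightarrow> nat \<Rightarrow> nat" where
  "chain_tuple n R B =
     (\<lambda>i\<in>{1..n}. kth_least (B (THE h. h \<in> {1..card R + 1} \<and> i \<in> carrel n R h)) i)"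

context carrels
begin

lemma gapless_step_empty: "gapless_step {} B'"
  by (simp add: gapless_step_def)

lemma gapless_chains_stepD: "B \<in> gapless_chains n R \<Longrightarrow> h \<le> r \<Longrightarrow> gapless_step (B h) (B (Suc h))"
  by (cases "h = 0") (auto simp: gapless_chains_def gapless_step_empty R_chains_def)

text \<open>The last step is gapless since [n] contains every integer between two of its elements.
  This reconciles clump deletion, where h runs to r, with 312-avoidance and gapless keys, where h
  stops at r - 1.\<close>

lemma gapless_chains_iff:
  assumes B: "B \<in> R_chains n R"
  shows "B \<in> gapless_chains n R \<longleftrightarrow> (\<forall>h\<in>{1..r - 1}. gapless_step (B h) (B (h + 1)))"
proof -
  have "gapless_step (B r) (B (r + 1))"
    using chain_last[OF B] chain_sub[OF B, of r] unfolding gapless_step_def by force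
  moreover have "h \<in> {1..r} \<longleftrightarrow> h \<in> {1..r - 1} \<or> 1 \<le> h \<and> h = r" for h by auto
  ultimately show ?thesis using B unfolding gapless_chains_def by blast
qed

lemma rightmost_clump_deleting_chains_eq:
  "rightmost_clump_deleting_chains n R = gapless_chains n R"
proof -
  have "gapless_step (B h) (B (h + 1)) \<longleftrightarrow>
      (\<exists>Ls. clump_list (B (h + 1)) Ls \<and>
       (\<exists>e\<in>{1..length Ls}. B (h + 1) - B h \<subseteq> \<Union>(set (drop (e - 1) Ls)) \<and>
          \<Union>(set (drop e Ls)) \<subseteq> B (h + 1) - B h))"
    if "B \<in> R_chains n R" "h \<in> {1..r}" for B h
    using that chain_finite[of B "h + 1"] chain_psubset[of B h]
    by (intro gapless_step_iff_clumps) auto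
  then show ?thesis unfolding rightmost_clump_deleting_chains_def gapless_chains_def by blast
qed

section \<open>Permutations and their chains\<close>

lemma perm_chain_apply: "h \<le> Suc r \<Longrightarrow> perm_chain n R \<pi> h = \<pi> ` {1..q h}"
  by (simp add: perm_chain_def)

lemma perm_chain_in_R_chains:
  assumes "\<pi> \<in> R_perms n R"
  shows "perm_chain n R \<pi> \<in> R_chains n R"
proof -
  have perm: "\<pi> permutes {1..n}" using assms by (simp add: R_perms_def)
  have inj: "inj \<pi>" using perm by (rule permutes_inj)
  have sub: "\<pi> ` {1..q h} \<subseteq> {1..n}" if "h \<le> Suc r" for h
  proof -
    have "\<pi> ` {1..q h} \<subseteq> \<pi> ` {1..n}" using q_le_n[of h] that by (intro image_mono) auto
    then show ?thesis using permutes_image[OF perm] by simp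
  qed
  have psub: "\<pi> ` {1..q h} \<subset> \<pi> ` {1..q (Suc h)}" if "h \<le> r" for h
  proof -
    have "{1..q h} \<subset> {1..q (Suc h)}" using q_less[of h "Suc h"] that by force
    then show ?thesis using inj by (metis inj_image_subset_iff psubset_eq inj_image_eq_iff)
  qed
  have card: "card (\<pi> ` {1..q h}) = q h" for h
    using inj by (subst card_image) (auto intro: inj_on_subset)
  show ?thesis unfolding R_chains_def
    using sub psub card permutes_image[OF perm]
    by (auto simp: perm_chain_apply perm_chain_def simp del: image_subset_iff)
qed

text \<open>A violation of gaplessness is a 312-pattern read by values: the new element is
  \<open>\<pi> b\<close>, the larger old one is \<open>\<pi> a\<close>, and an integer between them
  missing from the next set is \<open>\<pi> c\<close> with c beyond
  \<open>q (h + 1)\<close>.\<close>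

lemma perm_chain_312_iff:
  assumes "\<pi> \<in> R_perms n R"
  shows "\<not> R_312_containing n R \<pi> \<longleftrightarrow> perm_chain n R \<pi> \<in> gapless_chains n R"
proof -
  have perm: "\<pi> permutes {1..n}" using assms by (simp add: R_perms_def)
  have inj: "inj \<pi>" using perm by (rule permutes_inj)
  have "gapless_step (perm_chain n R \<pi> h) (perm_chain n R \<pi> (h + 1)) \<longleftrightarrow>
      \<not> (\<exists>a b c. 1 \<le> a \<and> a \<le> q h \<and> q h < b \<and> b \<le> q (h + 1) \<and>
        q (h + 1) < c \<and> c \<le> n \<and> \<pi> b < \<pi> c \<and> \<pi> c < \<pi> a)" (is "_ \<longleftrightarrow> \<not> ?containing")
    if h: "h \<in> {1..r - 1}" for h
  proof
    have app: "perm_chain n R \<pi> h = \<pi> ` {1..q h}"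
        "perm_chain n R \<pi> (h + 1) = \<pi> ` {1..q (h + 1)}"
      using h by (auto simp: perm_chain_apply)
    have le: "q (h + 1) \<le> n" using q_le_n[of "h + 1"] h by force
    show "\<not> ?containing" if "gapless_step (perm_chain n R \<pi> h) (perm_chain n R \<pi> (h + 1))"
    proof
      assume ?containing
      then obtain a b c where *: "1 \<le> a" "a \<le> q h" "q h < b" "b \<le> q (h + 1)"
        "q (h + 1) < c" "c \<le> n" "\<pi> b < \<pi> c" "\<pi> c < \<pi> a" by blast
      then have "\<pi> b \<in> \<pi> ` {1..q (h + 1)} - \<pi> ` {1..q h}" "\<pi> a \<in> \<pi> ` {1..q h}"
        using inj by (auto simp: inj_image_mem_iff)
      then have "\<pi> c \<in> \<pi> ` {1..q (h + 1)}"
        using that * unfolding gapless_step_def app by blast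
      then show False using inj * by (auto simp: inj_image_mem_iff)
    qed
    show "gapless_step (perm_chain n R \<pi> h) (perm_chain n R \<pi> (h + 1))" if "\<not> ?containing"
      unfolding gapless_step_def app
    proof (intro ballI allI impI)
      fix x y z assume x: "x \<in> \<pi> ` {1..q (h + 1)} - \<pi> ` {1..q h}" and y: "y \<in> \<pi> ` {1..q h}"
        and z: "x < z \<and> z < y"
      obtain b where b: "x = \<pi> b" "1 \<le> b" "b \<le> q (h + 1)" "q h < b"
        using x by (force simp: image_iff)
      obtain a where a: "y = \<pi> a" "1 \<le> a" "a \<le> q h" using y by auto
      have "x \<in> \<pi> ` {1..n}" "y \<in> \<pi> ` {1..n}" using a b le q_le_n[of h] h by auto
      then have "z \<in> {1..n}" using z permutes_image[OF perm] by auto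
      then obtain c where c: "z = \<pi> c" "1 \<le> c" "c \<le> n" using permutes_image[OF perm] by force
      have "c \<le> q (h + 1)"
      proof (rule ccontr)
        assume "\<not> ?thesis"
        then have ?containing using a b c z by (intro exI[of _ a] exI[of _ b] exI[of _ c]) auto
        then show False using that by contradiction
      qed
      then show "z \<in> \<pi> ` {1..q (h + 1)}" using c by auto
    qed
  qed
  then show ?thesis
    unfolding gapless_chains_iff[OF perm_chain_in_R_chains[OF assms]] R_312_containing_def by blast
qed

text \<open>The permutation lists each difference \<open>B (Suc h) - B h\<close> in increasing order
  along carrel h + 1.\<close>

lemma perm_chain_surj:
  assumes B: "B \<in> R_chains n R"
  obtains \<pi> where "\<pi> \<in> R_perms n R" "perm_chain n R \<pi> = B"
proof -
  \<comment> \<open>The description returns the carrel number \<open>Suc h\<close>; subtracting 1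
    gives the index of the smaller of the two chain sets.\<close>
  define idx where "idx = (\<lambda>i. (THE h. h \<in> {1..r + 1} \<and> i \<in> carrel n R h) - 1)"
  have idx: "idx i = h" if "h \<le> r" "i \<in> carrel n R (Suc h)" for i h
    using carrel_THE[OF that] by (simp add: idx_def)
  \<comment> \<open>Points outside [n] are fixed, as \<open>permutes\<close> demands.\<close>
  define \<pi> where "\<pi> i = (if i \<in> {1..n}
    then kth_least (B (Suc (idx i)) - B (idx i)) (i - q (idx i)) else i)" for i
  have card: "card (B (Suc h) - B h) = q (Suc h) - q h" if "h \<le> r" for h
    using that chain_psubset[OF B, of h] chain_card[OF B] chain_finite[OF B, of h]
    by (subst card_Diff_subset) auto
  have \<pi>: "\<pi> i = kth_least (B (Suc h) - B h) (i - q h)"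
    if "h \<le> r" "i \<in> carrel n R (Suc h)" for h i
    using idx[OF that] carrel_bounds[OF that] by (simp add: \<pi>_def)
  have mono: "strict_mono_on (carrel n R (Suc h)) \<pi>" if "h \<le> r" for h
  proof (rule strict_mono_onI)
    fix i k assume ik: "i \<in> carrel n R (Suc h)" "k \<in> carrel n R (Suc h)" "i < k"
    then show "\<pi> i < \<pi> k" using that card[OF that]
      by (auto simp: \<pi> carrel_Suc intro!: kth_least_less)
  qed
  have carrel_image: "\<pi> ` carrel n R (Suc h) = B (Suc h) - B h" if h: "h \<le> r" for h
  proof
    have fin: "finite (B (Suc h) - B h)" using chain_finite[OF B] h by simp
    show "\<pi> ` carrel n R (Suc h) \<subseteq> B (Suc h) - B h"
    proof
      fix x assume "x \<in> \<pi> ` carrel n R (Suc h)"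
      then obtain i where i: "i \<in> carrel n R (Suc h)" "x = \<pi> i" by blast
      have "1 \<le> i - q h" "i - q h \<le> card (B (Suc h) - B h)"
        using i card[OF h] by (auto simp: carrel_Suc)
      then show "x \<in> B (Suc h) - B h" using kth_least_mem[OF fin] i by (simp only: \<pi>[OF h])
    qed
    show "B (Suc h) - B h \<subseteq> \<pi> ` carrel n R (Suc h)"
    proof
      fix x assume "x \<in> B (Suc h) - B h"
      then obtain i where i: "1 \<le> i" "i \<le> card (B (Suc h) - B h)"
          "kth_least (B (Suc h) - B h) i = x"
        using kth_least_surj[OF fin] by blast
      then have "q h + i \<in> carrel n R (Suc h)" using card[OF h] by (auto simp: carrel_Suc)
      moreover from this have "\<pi> (q h + i) = x" using i by (simp add: \<pi>[OF h])
      ultimately show "x \<in> \<pi> ` carrel n R (Suc h)" by blast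
    qed
  qed
  have image: "\<pi> ` {1..q h} = B h" if "h \<le> Suc r" for h
    using that
  proof (induction h)
    case 0
    then show ?case using chain_0[OF B] by simp
  next
    case (Suc h)
    have "{1..q (Suc h)} = {1..q h} \<union> carrel n R (Suc h)"
      using q_le[of h "Suc h"] Suc.prems by (auto simp: carrel_Suc)
    then show ?case using Suc carrel_image[of h] chain_psubset[OF B, of h] by (auto simp: image_Un)
  qed
  have onto: "\<pi> ` {1..n} = {1..n}" using image[of "Suc r"] chain_last[OF B] by simp
  then have "bij_betw \<pi> {1..n} {1..n}" unfolding bij_betw_def
    by (auto intro: eq_card_imp_inj_on)
  then have "\<pi> permutes {1..n}" by (rule bij_imp_permutes) (auto simp: \<pi>_def)
  then have "\<pi> \<in> R_perms n R" using mono by (simp add: R_perms_def carrel_increasing_iff)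
  moreover have "perm_chain n R \<pi> = B"
  proof
    fix h show "perm_chain n R \<pi> h = B h"
    proof (cases "h \<le> Suc r")
      case True
      then show ?thesis using image by (simp add: perm_chain_apply)
    next
      case False
      then show ?thesis using chain_undefined[OF B, of h] by (simp add: perm_chain_def)
    qed
  qed
  ultimately show ?thesis using that by blast
qed

section \<open>Tuples read off from chains\<close>

lemma chain_tuple_eq:
  assumes "h \<le> r" "i \<in> carrel n R (Suc h)"
  shows "chain_tuple n R B i = kth_least (B (Suc h)) i"
  using carrel_THE[OF assms] carrel_bounds[OF assms] by (simp add: chain_tuple_def)

lemma Psi_eq_chain_tuple:
  assumes "\<pi> \<in> R_perms n R"
  shows "Psi n R \<pi> = chain_tuple n R (perm_chain n R \<pi>)"
proof
  fix i
  note B = perm_chain_in_R_chains[OF assms]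
  show "Psi n R \<pi> i = chain_tuple n R (perm_chain n R \<pi>) i"
  proof (cases "i \<in> {1..n}")
    case True
    then obtain h where h: "h \<le> r" "i \<in> carrel n R (Suc h)" using carrel_cover[OF True] by blast
    let ?Q = "\<pi> ` {1..q (Suc h)}"
    have Q: "perm_chain n R \<pi> (Suc h) = ?Q" using h by (simp add: perm_chain_apply)
    then have card: "card ?Q = q (Suc h)" using chain_card[OF B, of "Suc h"] h by simp
    have "Psi n R \<pi> i = rank_desc (card ?Q - i + 1) ?Q"
      unfolding card using True carrel_THE[OF h] by (simp add: Psi_def)
    also have "\<dots> = kth_least ?Q i"
      using h carrel_bounds[OF h] card by (intro rank_desc_kth_least) (auto simp: carrel_Suc)
    finally show ?thesis using chain_tuple_eq[OF h] Q by simp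
  next
    case False
    then show ?thesis unfolding Psi_def chain_tuple_def restrict_def by (simp only: if_False)
  qed
qed

text \<open>At the end of carrel h the tuple takes the largest element \<open>?m\<close> of
  \<open>B h\<close>, and next the element \<open>?c\<close> of rank \<open>q h + 1\<close> in
  \<open>B (Suc h)\<close>. If \<open>?c < ?m\<close>, gaplessness puts all of
  \<open>{?c..?m}\<close> into \<open>B (Suc h)\<close>, so these values take consecutive ranks.
  That is the run of length s required by \<open>UG\<close>.\<close>

lemma chain_tuple_in_UG:
  assumes G: "B \<in> gapless_chains n R"
  shows "chain_tuple n R B \<in> UG n R"
proof -
  have B: "B \<in> R_chains n R" using G by (simp add: gapless_chains_def)
  let ?\<gamma> = "chain_tuple n R B"
  have mem: "?\<gamma> i \<in> {1..n} \<and> i \<le> ?\<gamma> i" if i: "i \<in> {1..n}" for i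
  proof -
    obtain h where h: "h \<le> r" "i \<in> carrel n R (Suc h)" using carrel_cover[OF i] by blast
    then have i': "1 \<le> i" "i \<le> card (B (Suc h))"
      using chain_card[OF B, of "Suc h"] carrel_bounds[OF h] by (auto simp: carrel_Suc)
    then show ?thesis
      using kth_least_mem[of "B (Suc h)" i] le_kth_least[OF chain_sub[OF B, of "Suc h"] i']
        chain_finite[OF B, of "Suc h"] chain_sub[OF B, of "Suc h"] h
      by (auto simp: chain_tuple_eq)
  qed
  have mono: "strict_mono_on (carrel n R (Suc h)) ?\<gamma>" if "h \<le> r" for h
  proof (rule strict_mono_onI)
    fix i k assume "i \<in> carrel n R (Suc h)" "k \<in> carrel n R (Suc h)" "i < k"
    then show "?\<gamma> i < ?\<gamma> k"
      using that chain_card[OF B, of "Suc h"] carrel_bounds[OF that]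
      by (auto simp: chain_tuple_eq carrel_Suc intro!: kth_least_less)
  qed
  have UI: "?\<gamma> \<in> UI n R" using mem mono
    by (auto simp: UI_def carrel_increasing_iff chain_tuple_def)
  have "let s = ?\<gamma> (q h) - ?\<gamma> (q h + 1) + 1 in s \<le> pval n R (h + 1) \<and>
        (\<forall>t\<in>{1..s}. ?\<gamma> (q h + t) = ?\<gamma> (q h) - s + t)"
    if h: "h \<in> {1..r}" and drop: "?\<gamma> (q h + 1) < ?\<gamma> (q h)" for h
  proof -
    let ?c = "?\<gamma> (q h + 1)" and ?m = "?\<gamma> (q h)" and ?B' = "B (Suc h)"
    have qs: "q (h - 1) < q h" "q h < q (Suc h)" using h by (auto intro!: q_less)
    have cards: "card (B h) = q h" "card ?B' = q (Suc h)" using chain_card[OF B] h by auto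
    have fin: "finite ?B'" "finite (B h)" using chain_finite[OF B] h by auto
    have hr: "h \<le> r" "h - 1 \<le> r" "Suc (h - 1) = h" using h by auto
    have c: "?c = kth_least ?B' (q h + 1)"
      using qs hr by (intro chain_tuple_eq) (auto simp: carrel_Suc)
    have m: "?m = kth_least (B h) (q h)"
      using qs hr chain_tuple_eq[of "h - 1" "q h" B] by (auto simp: mem_carrel_iff)
    have "?m \<in> B h" using kth_least_mem[OF fin(2), of "q h"] cards qs m by simp
    then have sub: "{?c..?m} \<subseteq> ?B'"
      using gapless_step_above[OF fin(1) chain_psubset[OF B hr(1)], of ?m]
        gapless_chains_stepD[OF G hr(1)] cards c drop by simp
    \<comment> \<open>Here t counts from 0 at position \<open>q h + 1\<close>; in \<open>UG\<close>
      it counts from 1, which explains the shift by one further down.\<close>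
    have run: "q h + 1 + t \<le> q (Suc h)" "?\<gamma> (q h + 1 + t) = ?c + t" if "t \<le> ?m - ?c" for t
    proof -
      have "{?c..?c + t} \<subseteq> {?c..?m}" using that drop by auto
      then have "{kth_least ?B' (q h + 1)..kth_least ?B' (q h + 1) + t} \<subseteq> ?B'"
        using sub c by auto
      then have k: "q h + 1 + t \<le> card ?B'"
          "kth_least ?B' (q h + 1 + t) = kth_least ?B' (q h + 1) + t"
        using kth_least_consecutive[OF fin(1), of "q h + 1" t] cards qs by auto
      then show "q h + 1 + t \<le> q (Suc h)" using cards by simp
      then have "?\<gamma> (q h + 1 + t) = kth_least ?B' (q h + 1 + t)"
        using hr by (intro chain_tuple_eq) (auto simp: carrel_Suc)
      then show "?\<gamma> (q h + 1 + t) = ?c + t" using k c by simp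
    qed
    have "?m - ?c + 1 \<le> pval n R (h + 1)" using run(1)[of "?m - ?c"] by (simp add: pval_def)
    moreover have "?\<gamma> (q h + t) = ?m - (?m - ?c + 1) + t" if t: "t \<in> {1..?m - ?c + 1}" for t
    proof -
      have "q h + t = q h + 1 + (t - 1)" "t - 1 \<le> ?m - ?c" using t by auto
      then have "?\<gamma> (q h + t) = ?c + (t - 1)" using run(2)[of "t - 1"] by simp
      \<comment> \<open>Positivity of \<open>?c\<close> keeps the subtraction of
        \<open>?m - ?c + 1\<close> from \<open>?m\<close> from truncating.\<close>
      moreover have "1 \<le> ?c" using mem[of "q h + 1"] qs q_le_n[of "Suc h"] hr by auto
      ultimately show ?thesis using t drop by auto
    qed
    ultimately show ?thesis by (simp add: Let_def)
  qed
  then show ?thesis using UI unfolding UG_def by blast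
qed

text \<open>Iterates \<open>gapless_extension\<close> by dependent choice, starting from the empty
  set.\<close>

lemma chain_tuple_surj:
  assumes \<gamma>: "\<gamma> \<in> UG n R"
  obtains B where "B \<in> gapless_chains n R" "chain_tuple n R B = \<gamma>"
proof -
  have bound: "\<forall>i\<in>{1..n}. i \<le> \<gamma> i \<and> \<gamma> i \<le> n"
    and mono: "\<And>h. h \<le> r \<Longrightarrow> strict_mono_on {q h<..q (Suc h)} \<gamma>"
    and ext: "\<gamma> \<in> extensional {1..n}"
    using \<gamma> by (auto simp: UG_def UI_def carrel_increasing_iff carrel_Suc PiE_iff)
  have gap: "\<gamma> (q h) - \<gamma> (q h + 1) + 1 \<le> q (Suc h) - q h \<and>
      (\<forall>t\<in>{1..\<gamma> (q h) - \<gamma> (q h + 1) + 1}.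
        \<gamma> (q h + t) = \<gamma> (q h) - (\<gamma> (q h) - \<gamma> (q h + 1) + 1) + t)"
    if "h \<in> {1..r}" "\<gamma> (q h + 1) < \<gamma> (q h)" for h
    using \<gamma> that by (auto simp: UG_def Let_def pval_def)
  \<comment> \<open>The bounds on h make both conditions vacuous past the end of the chain, so the
    choice can run over all natural numbers.\<close>
  let ?P = "\<lambda>h B. h \<le> Suc r \<longrightarrow> B \<subseteq> {1..n} \<and> card B = q h \<and> (h = 0 \<longrightarrow> B = {}) \<and>
    (\<forall>i\<in>carrel n R h. kth_least B i = \<gamma> i)"
  let ?Q = "\<lambda>h B B'. h \<le> r \<longrightarrow> B \<subseteq> B' \<and> gapless_step B B'"
  have "\<exists>B. \<forall>h. ?P h (B h) \<and> ?Q h (B h) (B (Suc h))"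
  proof (rule dependent_nat_choice)
    show "\<exists>B. ?P 0 B" by (rule exI[of _ "{}"]) (simp add: carrel_def)
    fix B h assume P: "?P h B"
    show "\<exists>B'. ?P (Suc h) B' \<and> ?Q h B B'"
    proof (cases "h \<le> r")
      case True
      note True' = this
      let ?c = "\<gamma> (q h + 1)"
      have B: "B \<subseteq> {1..n}" "card B = q h" "\<forall>i\<in>carrel n R h. kth_least B i = \<gamma> i"
        and B0: "h = 0 \<Longrightarrow> B = {}" using P True by auto
      have fin: "finite B" using B finite_subset by blast
      have less: "q h < q (Suc h)" using q_less[of h "Suc h"] True by simp
      \<comment> \<open>The hypothesis of \<open>gapless_extension\<close>. Any \<open>y\<close> in
        \<open>B\<close> is at most \<open>\<gamma> (q h)\<close>, the largest element of
        \<open>B\<close>. If \<open>?c\<close> lies below that value, the run prescribed by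
        \<open>UG\<close> takes each value z up to it, at position
        \<open>q h + (z - ?c + 1)\<close>.\<close>
      have above: "{?c..y} \<subseteq> \<gamma> ` {q h<..q (Suc h)}" if y: "y \<in> B" "?c \<le> y" for y
      proof
        fix z assume z: "z \<in> {?c..y}"
        have h: "h \<in> {1..r}" using B0 y True by (cases h) auto
        then have "q h \<in> carrel n R h" using q_less[of "h - 1" h] by (simp add: mem_carrel_iff)
        then have "y \<le> \<gamma> (q h)" using le_kth_least_card[OF fin y(1)] B by simp
        show "z \<in> \<gamma> ` {q h<..q (Suc h)}"
        proof (cases "z = ?c")
          case True
          then show ?thesis using less by auto
        next
          case False
          let ?t = "z - ?c + 1" and ?s = "\<gamma> (q h) - ?c + 1"
          have drop: "?c < \<gamma> (q h)" "z \<le> \<gamma> (q h)" "?c < z" using False z \<open>y \<le> \<gamma> (q h)\<close> by auto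
          then have t: "?t \<in> {1..?s}" by auto
          then have "\<gamma> (q h + ?t) = \<gamma> (q h) - ?s + ?t" using gap[OF h drop(1)] by blast
          moreover have "1 \<le> ?c" using bound[rule_format, of "q h + 1"] less q_le_n[of "Suc h"] True' by simp
          ultimately have "\<gamma> (q h + ?t) = z" using drop by simp
          moreover have "q h + ?t \<in> {q h<..q (Suc h)}" using gap[OF h drop(1)] t less by auto
          ultimately show ?thesis by (metis imageI)
        qed
      qed
      have "\<forall>i\<in>{q h<..q (Suc h)}. i \<le> \<gamma> i \<and> \<gamma> i \<le> n"
        using bound q_le_n[of "Suc h"] True by auto
      moreover have "\<forall>y\<in>B. ?c \<le> y \<longrightarrow> {?c..y} \<subseteq> \<gamma> ` {q h<..q (Suc h)}"
        using above by blast
      ultimately obtain B' where "B \<subseteq> B'" "B' \<subseteq> {1..n}" "card B' = q (Suc h)"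
        "\<forall>i\<in>{q h<..q (Suc h)}. kth_least B' i = \<gamma> i" "gapless_step B B'"
        by (rule gapless_extension[OF B(1,2) less mono[OF True]])
      then show ?thesis by (intro exI[of _ B']) (simp add: carrel_Suc)
    qed auto
  qed
  then obtain B where B: "\<forall>h. ?P h (B h) \<and> ?Q h (B h) (B (Suc h))" by (rule exE)
  have P: "?P h (B h)" for h using spec[OF B, of h] by (rule conjunct1)
  have Q: "?Q h (B h) (B (Suc h))" for h using spec[OF B, of h] by (rule conjunct2)
  \<comment> \<open>Restriction to the index set makes the chosen sequence an extensional function,
    as in the encoding of chains.\<close>
  define B' where "B' = restrict B {0..r + 1}"
  have B': "B' h = B h" if "h \<le> Suc r" for h using that by (simp add: B'_def)
  have last: "B (Suc r) = {1..n}"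
    using P[of "Suc r"] by (intro card_subset_eq) auto
  have psub: "B h \<subset> B (Suc h)" if "h \<le> r" for h
    using P[of h] P[of "Suc h"] Q[of h] q_less[of h "Suc h"] that by auto
  have "B' \<in> R_chains n R" unfolding R_chains_def
  proof (intro CollectI conjI)
    show "B' \<in> {0..r + 1} \<rightarrow>\<^sub>E Pow {1..n}"
      unfolding B'_def using P by (simp add: restrict_PiE_iff)
  qed (use P last psub in \<open>auto simp: B'\<close>)
  then have "B' \<in> gapless_chains n R" using Q by (auto simp: gapless_chains_def B')
  moreover have "chain_tuple n R B' = \<gamma>"
  proof
    fix i show "chain_tuple n R B' i = \<gamma> i"
    proof (cases "i \<in> {1..n}")
      case True
      then obtain h where h: "h \<le> r" "i \<in> carrel n R (Suc h)" using carrel_cover[OF True] by blast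
      then show ?thesis using P[of "Suc h"] by (simp add: chain_tuple_eq B')
    next
      case False
      then show ?thesis using ext by (auto simp: chain_tuple_def extensional_def)
    qed
  qed
  ultimately show ?thesis using that by blast
qed

end

section \<open>Keys and row end maximal tableaux\<close>

locale partition_shape =
  fixes n :: nat and lam :: "nat \<Rightarrow> nat"
  assumes n_ge_1: "1 \<le> n" and partition: "is_partition n lam"
begin

abbreviation "R \<equiv> R_of n lam"
abbreviation "\<zeta> \<equiv> col_len n lam"

section \<open>Column lengths and row ends of a partition\<close>

lemma lam_antimono: "1 \<le> i \<Longrightarrow> i \<le> k \<Longrightarrow> k \<le> n \<Longrightarrow> lam k \<le> lam i"
  using partition by (auto simp: is_partition_def)

text \<open>The column lengths form the conjugate partition: as \<open>lam\<close> is weakly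
  decreasing, the rows that reach column j are an initial segment of [n].\<close>

lemma le_col_len_iff:
  assumes "1 \<le> i" "i \<le> n"
  shows "i \<le> \<zeta> j \<longleftrightarrow> j \<le> lam i"
proof
  let ?S = "{i \<in> {1..n}. j \<le> lam i}"
  show "i \<le> \<zeta> j" if "j \<le> lam i"
  proof -
    have "{1..i} \<subseteq> ?S" using that assms lam_antimono[of _ i] by (auto intro: order_trans)
    then have "card {1..i} \<le> card ?S" by (intro card_mono) auto
    then show ?thesis by (simp add: col_len_def)
  qed
  show "j \<le> lam i" if "i \<le> \<zeta> j"
  proof (rule ccontr)
    assume "\<not> ?thesis"
    then have "k < i" if "k \<in> ?S" for k
      using that lam_antimono[of i k] assms by (cases "k < i") auto
    then have "?S \<subseteq> {1..<i}" by auto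
    then have "card ?S \<le> card {1..<i}" by (intro card_mono) auto
    then show False using \<open>i \<le> \<zeta> j\<close> assms by (simp add: col_len_def)
  qed
qed

lemma col_len_le: "\<zeta> j \<le> n"
proof -
  have "\<zeta> j \<le> card {1..n}" unfolding col_len_def by (intro card_mono) auto
  then show ?thesis by simp
qed

lemma col_len_pos: "j \<le> lam 1 \<Longrightarrow> 1 \<le> \<zeta> j"
  using le_col_len_iff[of 1 j] n_ge_1 by simp

lemma col_len_antimono: "j \<le> l \<Longrightarrow> \<zeta> l \<le> \<zeta> j"
  unfolding col_len_def by (intro card_mono) auto

sublocale carrels n "R_of n lam"
proof
  show "R \<subseteq> {1..<n}" using col_len_pos by (auto simp: R_of_def)
qed (rule n_ge_1)

lemma col_len_cases:
  assumes "j \<in> {1..lam 1}"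
  obtains h where "h \<le> r" "\<zeta> j = q (Suc h)"
proof (cases "\<zeta> j = n")
  case True
  then show ?thesis using that[of r] by simp
next
  case False
  then have "\<zeta> j \<in> R" using assms col_len_le[of j] unfolding R_of_def by (auto simp: less_le)
  then obtain h where "h \<in> {1..r}" "\<zeta> j = q h" using q_image by (metis imageE)
  then have "h - 1 \<le> r" "\<zeta> j = q (Suc (h - 1))" by auto
  then show ?thesis by (rule that)
qed

lemma q_Suc_bounds: "h \<le> r \<Longrightarrow> 1 \<le> q (Suc h) \<and> q (Suc h) \<le> n"
  using q_less[of 0 "Suc h"] q_le_n[of "Suc h"] by simp

lemma lam_le_lam_1: "1 \<le> i \<Longrightarrow> i \<le> n \<Longrightarrow> lam i \<le> lam 1"
  using lam_antimono[of 1 i] by simp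

lemma lam_q_antimono: "h \<le> k \<Longrightarrow> k \<le> r \<Longrightarrow> lam (q (Suc k)) \<le> lam (q (Suc h))"
  using q_Suc_bounds[of h] q_Suc_bounds[of k] q_le[of "Suc h" "Suc k"] by (intro lam_antimono) auto

text \<open>All rows of a carrel end in the same column. A row i beyond \<open>q h\<close> ending in
  column \<open>lam i\<close> makes that column longer than \<open>q h\<close>; as column lengths
  are values of \<open>q\<close>, it reaches row \<open>q (Suc h)\<close>.\<close>

lemma lam_carrel:
  assumes h: "h \<le> r" and i: "i \<in> carrel n R (Suc h)"
  shows "lam i = lam (q (Suc h))"
proof (rule antisym)
  have b: "1 \<le> i" "i \<le> n" "q h < i" "i \<le> q (Suc h)"
    using carrel_bounds[OF assms] i by (auto simp: carrel_Suc)
  show "lam (q (Suc h)) \<le> lam i" using b q_Suc_bounds[OF h] by (intro lam_antimono) auto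
  show "lam i \<le> lam (q (Suc h))"
  proof (cases "lam i = 0")
    case False
    then have "lam i \<in> {1..lam 1}" using lam_le_lam_1 b by auto
    then obtain k where k: "k \<le> r" "\<zeta> (lam i) = q (Suc k)" using col_len_cases by blast
    have "i \<le> \<zeta> (lam i)" using le_col_len_iff b by blast
    then have "q h < q (Suc k)" using k b by simp
    then have "h \<le> k" using q_le[of "Suc k" h] h by (cases "h \<le> k") auto
    then have "q (Suc h) \<le> \<zeta> (lam i)" using k q_le[of "Suc h" "Suc k"] by simp
    then show ?thesis using le_col_len_iff q_Suc_bounds[OF h] by blast
  qed simp
qed

lemma col_len_lam_q:
  assumes h: "h \<le> r"
  shows "\<zeta> (lam (q (Suc h))) = q (Suc h)"
proof (rule antisym)
  show "q (Suc h) \<le> \<zeta> (lam (q (Suc h)))" using le_col_len_iff q_Suc_bounds[OF h] by blast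
  show "\<zeta> (lam (q (Suc h))) \<le> q (Suc h)"
  proof (cases "h = r")
    \<comment> \<open>Here \<open>lam n\<close> may be 0; index 0 is not a column, but
      \<open>\<zeta> 0 = n\<close> still holds because every row satisfies the condition that
      \<open>\<zeta>\<close> counts.\<close>
    case True
    then show ?thesis using col_len_le by simp
  next
    case False
    then have "q (Suc h) \<in> R" using q_image h by force
    then obtain j where j: "q (Suc h) = \<zeta> j" by (auto simp: R_of_def)
    then have "j \<le> lam (q (Suc h))" using le_col_len_iff q_Suc_bounds[OF h] by (metis order_refl)
    then show ?thesis using col_len_antimono j by simp
  qed
qed

lemma lam_q_pos:
  assumes h: "Suc h \<le> r"
  shows "1 \<le> lam (q (Suc h))"
proof -
  have "q (Suc h) \<in> R" using q_image h by (metis atLeastAtMost_iff image_eqI le_add1 plus_1_eq_Suc)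
  then obtain j where j: "q (Suc h) = \<zeta> j" "1 \<le> j" by (auto simp: R_of_def)
  then show ?thesis using le_col_len_iff[of "q (Suc h)" j] q_Suc_bounds[of h] h by simp
qed

text \<open>Places the columns of one length in the block that the portrayal fills with copies of a
  single chain set.\<close>

lemma col_index_bounds:
  assumes "\<zeta> j = q (Suc h)" "h \<le> r"
  shows "j \<le> lam (q (Suc h))" "h < r \<Longrightarrow> lam (q (Suc (Suc h))) < j"
proof -
  show "j \<le> lam (q (Suc h))" using assms le_col_len_iff q_Suc_bounds by (metis order_refl)
  assume "h < r"
  then show "lam (q (Suc (Suc h))) < j"
    using assms le_col_len_iff[of "q (Suc (Suc h))" j] q_Suc_bounds[of "Suc h"]
      q_less[of "Suc h" "Suc (Suc h)"] by simp
qed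

section \<open>Portrayals of chains and keys\<close>

lemma boxes_iff: "(j, i) \<in> boxes n lam \<longleftrightarrow> j \<in> {1..lam 1} \<and> 1 \<le> i \<and> i \<le> \<zeta> j"
  by (auto simp: boxes_def)

text \<open>Proved by adding the blocks from left to right, that is, by induction on m downwards
  from r.\<close>

lemma portrayal_columns_nth:
  assumes last: "B (Suc r) = {1..n}" and j: "1 \<le> j" "\<zeta> j = q (Suc h)" "h \<le> r"
  shows "portrayal_columns n lam B ! (j - 1) = B (Suc h)"
proof -
  let ?f = "\<lambda>h. replicate (lam (q h) - lam (q (h + 1))) (B h)"
  \<comment> \<open>\<open>?L m\<close> is the initial part of the column list up to the copies of
    \<open>B (Suc m)\<close>. It has length \<open>lam (q (Suc m))\<close>; for \<open>m = r\<close>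
    it consists of the copies of [n], and for \<open>m = 0\<close> it is the whole list.\<close>
  let ?L = "\<lambda>m. replicate (lam n) {1..n} @ concat (map ?f (rev [Suc m..<r + 1]))"
  have "length (?L m) = lam (q (Suc m)) \<and>
      (\<forall>h j. m \<le> h \<and> h \<le> r \<and> 1 \<le> j \<and> j \<le> lam (q (Suc h)) \<and> (h < r \<longrightarrow> lam (q (Suc (Suc h))) < j)
        \<longrightarrow> ?L m ! (j - 1) = B (Suc h))" if "m \<le> r" for m
    using that
  proof (induction rule: inc_induct)
    case base
    then show ?case using last by auto
  next
    case (step m)
    let ?L' = "?L (Suc m)" and ?k = "lam (q (Suc m)) - lam (q (Suc (Suc m)))"
    have L: "?L m = ?L' @ replicate ?k (B (Suc m))"
    proof -
      have "[Suc m..<r + 1] = Suc m # [Suc (Suc m)..<r + 1]"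
        using step.hyps by (subst upt_conv_Cons) auto
      then show ?thesis by (simp del: upt_Suc)
    qed
    have len: "length ?L' = lam (q (Suc (Suc m)))" using step.IH by blast
    have le: "lam (q (Suc (Suc m))) \<le> lam (q (Suc m))"
      using lam_q_antimono[of m "Suc m"] step.hyps by simp
    have "?L m ! (j - 1) = B (Suc h)"
      if hj: "m \<le> h" "h \<le> r" "1 \<le> j" "j \<le> lam (q (Suc h))" "h < r \<longrightarrow> lam (q (Suc (Suc h))) < j" for h j
    proof (cases "h = m")
      case True
      then have "length ?L' \<le> j - 1" "j - 1 - length ?L' < ?k"
        using hj step.hyps le len by auto
      then show ?thesis using True unfolding L nth_append by simp
    next
      case False
      then have "Suc m \<le> h" using hj by simp
      then have "?L' ! (j - 1) = B (Suc h)" using step.IH hj by blast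
      moreover have "j - 1 < length ?L'"
        using lam_q_antimono[of "Suc m" h] hj \<open>Suc m \<le> h\<close> unfolding len by linarith
      ultimately show ?thesis unfolding L nth_append by simp
    qed
    moreover have "length (?L m) = lam (q (Suc m))" unfolding L using len le by simp
    ultimately show ?case by blast
  qed
  from this[of 0] have "?L 0 ! (j - 1) = B (Suc h)"
    using j col_index_bounds[OF j(2,3)] by blast
  then show ?thesis by (simp add: portrayal_columns_def Let_def)
qed

lemma portrayal_apply:
  assumes B: "B \<in> R_chains n R" and "(j, i) \<in> boxes n lam" "\<zeta> j = q (Suc h)" "h \<le> r"
  shows "portrayal n lam B (j, i) = kth_least (B (Suc h)) i"
  using assms portrayal_columns_nth[of B j h, OF chain_last[OF B]]
  by (simp add: portrayal_def kth_least_def boxes_iff)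

lemma col_set_portrayal:
  assumes B: "B \<in> R_chains n R" and j: "j \<in> {1..lam 1}" "\<zeta> j = q (Suc h)" "h \<le> r"
  shows "col_set n lam (portrayal n lam B) j = B (Suc h)"
proof -
  have card: "card (B (Suc h)) = \<zeta> j" and fin: "finite (B (Suc h))"
    using chain_card[OF B, of "Suc h"] chain_finite[OF B, of "Suc h"] j by auto
  have "col_set n lam (portrayal n lam B) j = kth_least (B (Suc h)) ` {1..\<zeta> j}"
    unfolding col_set_def using portrayal_apply[OF B _ j(2,3)] j by (force simp: boxes_iff)
  also have "\<dots> = B (Suc h)"
  proof
    show "kth_least (B (Suc h)) ` {1..\<zeta> j} \<subseteq> B (Suc h)"
      using card fin by (auto intro: kth_least_mem)
    show "B (Suc h) \<subseteq> kth_least (B (Suc h)) ` {1..\<zeta> j}"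
      using card kth_least_surj[OF fin] by (metis atLeastAtMost_iff image_eqI subsetI)
  qed
  finally show ?thesis .
qed

lemma portrayal_in_lam_keys:
  assumes B: "B \<in> R_chains n R"
  shows "portrayal n lam B \<in> lam_keys n lam"
proof -
  let ?Y = "portrayal n lam B"
  have cards: "card (B (Suc h)) = q (Suc h)" "finite (B (Suc h))" if "h \<le> r" for h
    using chain_card[OF B, of "Suc h"] chain_finite[OF B, of "Suc h"] that by auto
  have nested: "k \<le> h \<and> B (Suc k) \<subseteq> B (Suc h)"
    if "j \<le> l" "\<zeta> j = q (Suc h)" "\<zeta> l = q (Suc k)" "h \<le> r" "k \<le> r" for j l h k
  proof -
    have "q (Suc k) \<le> q (Suc h)" using col_len_antimono[OF that(1)] that by simp
    then have "k \<le> h" using q_less[of "Suc h" "Suc k"] that by (cases "k \<le> h") auto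
    then show ?thesis using chain_mono[OF B, of "Suc k" "Suc h"] that by simp
  qed
  have mem: "?Y (j, i) \<in> {1..n}" if "(j, i) \<in> boxes n lam" for j i
  proof -
    have j: "j \<in> {1..lam 1}" "1 \<le> i" "i \<le> \<zeta> j" using that by (auto simp: boxes_iff)
    obtain h where h: "h \<le> r" "\<zeta> j = q (Suc h)" using col_len_cases[OF j(1)] by blast
    then show ?thesis
      using portrayal_apply[OF B that h(2,1)] kth_least_mem[of "B (Suc h)" i] cards[of h] j
        chain_sub[OF B, of "Suc h"] by auto
  qed
  have strict: "?Y (j, i) < ?Y (j, k)"
    if "(j, i) \<in> boxes n lam" "(j, k) \<in> boxes n lam" "i < k" for j i k
  proof -
    have j: "j \<in> {1..lam 1}" "1 \<le> i" "k \<le> \<zeta> j" using that by (auto simp: boxes_iff)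
    obtain h where h: "h \<le> r" "\<zeta> j = q (Suc h)" using col_len_cases[OF j(1)] by blast
    then show ?thesis
      using portrayal_apply[OF B _ h(2,1)] kth_least_less[of i k "B (Suc h)"] cards[of h] j that
      by simp
  qed
  have weak: "?Y (j, i) \<le> ?Y (l, i)"
    if "(j, i) \<in> boxes n lam" "(l, i) \<in> boxes n lam" "j \<le> l" for j l i
  proof -
    have j: "j \<in> {1..lam 1}" "l \<in> {1..lam 1}" "1 \<le> i" "i \<le> \<zeta> l" using that by (auto simp: boxes_iff)
    obtain h where h: "h \<le> r" "\<zeta> j = q (Suc h)" using col_len_cases[OF j(1)] by blast
    obtain k where k: "k \<le> r" "\<zeta> l = q (Suc k)" using col_len_cases[OF j(2)] by blast
    show ?thesis
      using portrayal_apply[OF B that(1) h(2,1)] portrayal_apply[OF B that(2) k(2,1)]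
        nested[OF that(3) h(2) k(2) h(1) k(1)] cards[OF h(1)] cards[OF k(1)] j k
        kth_least_antimono[of "B (Suc h)" "B (Suc k)" i] by simp
  qed
  have "?Y \<in> tableaux n lam"
    unfolding tableaux_def using mem strict weak by (force simp: PiE_iff portrayal_def)
  moreover have "col_set n lam ?Y j \<subseteq> col_set n lam ?Y l"
    if l: "l \<in> {1..lam 1}" and j: "j \<in> {1..lam 1}" and "l \<le> j" for l j
  proof -
    obtain h where h: "h \<le> r" "\<zeta> j = q (Suc h)" using col_len_cases[OF j] by blast
    obtain k where k: "k \<le> r" "\<zeta> l = q (Suc k)" using col_len_cases[OF l] by blast
    show ?thesis
      using col_set_portrayal[OF B j h(2,1)] col_set_portrayal[OF B l k(2,1)]
        nested[OF \<open>l \<le> j\<close> k(2) h(2) k(1) h(1)] by simp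
  qed
  ultimately show ?thesis by (simp add: lam_keys_def)
qed

lemma row_end_column: "Suc h \<le> r \<Longrightarrow> lam (q (Suc h)) \<in> {1..lam 1}"
  using lam_q_pos[of h] lam_le_lam_1[of "q (Suc h)"] q_Suc_bounds[of h] by simp

text \<open>The bound on h guarantees a column of this length, by \<open>lam_q_pos\<close>; columns
  of length n may be absent.\<close>

lemma values_in_cols_portrayal:
  assumes B: "B \<in> R_chains n R" and h: "Suc h \<le> r"
  shows "values_in_cols_of_length n lam (portrayal n lam B) (q (Suc h)) = B (Suc h)"
proof -
  have "lam (q (Suc h)) \<in> {j \<in> {1..lam 1}. \<zeta> j = q (Suc h)}"
    using row_end_column[OF h] col_len_lam_q[of h] h by simp
  moreover have "col_set n lam (portrayal n lam B) j = B (Suc h)"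
    if "j \<in> {j \<in> {1..lam 1}. \<zeta> j = q (Suc h)}" for j
    using that h by (intro col_set_portrayal[OF B]) auto
  ultimately show ?thesis unfolding values_in_cols_of_length_def by blast
qed

lemma portrayal_gapless_iff:
  assumes B: "B \<in> R_chains n R"
  shows "portrayal n lam B \<in> gapless_keys n lam \<longleftrightarrow> B \<in> gapless_chains n R"
proof -
  let ?V = "values_in_cols_of_length n lam (portrayal n lam B)"
  have "gapless_step (B h) (B (h + 1)) \<longleftrightarrow>
      (Min (?V (q (h + 1)) - ?V (q h)) < Max (?V (q h)) \<longrightarrow>
        {Min (?V (q (h + 1)) - ?V (q h))..Max (?V (q h))} \<subseteq> ?V (q (h + 1)))"
    if h: "h \<in> {1..r - 1}" for h
  proof -
    have hr: "Suc h \<le> r" "h \<le> r" "Suc (h - 1) = h" using h by auto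
    have V: "?V (q (h + 1)) = B (h + 1)" "?V (q h) = B h"
      using values_in_cols_portrayal[OF B, of h] values_in_cols_portrayal[OF B, of "h - 1"] hr
      by auto
    have "0 < card (B h)" using chain_card[OF B, of h] q_less[of 0 h] hr by simp
    then have "B h \<noteq> {}" by auto
    then show ?thesis unfolding V
      using chain_finite[OF B, of "h + 1"] chain_psubset[OF B, of h] hr
      by (intro gapless_step_iff_Min_Max) auto
  qed
  then show ?thesis
    unfolding gapless_chains_iff[OF B] gapless_keys_def Let_def
    using portrayal_in_lam_keys[OF B] by blast
qed

text \<open>The sets with index from 1 to r are recovered from the columns of the matching length;
  the first and last sets are the same for all chains, and beyond them chains are undefined.\<close>

lemma portrayal_inj: "inj_on (portrayal n lam) (R_chains n R)"
proof (rule inj_onI, rule ext)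
  fix B B' h assume B: "B \<in> R_chains n R" and B': "B' \<in> R_chains n R"
    and eq: "portrayal n lam B = portrayal n lam B'"
  consider "h = 0" | "h = Suc r" | "1 \<le> h" "h \<le> r" | "Suc r < h" by linarith
  then show "B h = B' h"
  proof cases
    case 3
    then have "Suc (h - 1) = h" by simp
    then show ?thesis
      using values_in_cols_portrayal[OF B, of "h - 1"] values_in_cols_portrayal[OF B', of "h - 1"]
        eq 3 by simp
  next
    case 4
    then show ?thesis using chain_undefined[OF B] chain_undefined[OF B'] by simp
  qed (use chain_0[OF B] chain_0[OF B'] chain_last[OF B] chain_last[OF B'] in auto)
qed

text \<open>Columns of equal length in a key have nested entry sets of equal size, so they coincide
  and each length determines one set.\<close>

lemma portrayal_surj:
  assumes Y: "Y \<in> lam_keys n lam"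
  obtains B where "B \<in> R_chains n R" "portrayal n lam B = Y"
proof -
  let ?C = "col_set n lam Y"
  have T: "Y \<in> boxes n lam \<rightarrow>\<^sub>E {1..n}"
    and strict: "\<And>j i k. (j, i) \<in> boxes n lam \<Longrightarrow> (j, k) \<in> boxes n lam \<Longrightarrow> i < k \<Longrightarrow> Y (j, i) < Y (j, k)"
    and nested: "\<And>l j. l \<in> {1..lam 1} \<Longrightarrow> j \<in> {1..lam 1} \<Longrightarrow> l \<le> j \<Longrightarrow> ?C j \<subseteq> ?C l"
    using Y by (auto simp: lam_keys_def tableaux_def)
  have C: "?C j = (\<lambda>i. Y (j, i)) ` {1..\<zeta> j}" for j by (auto simp: col_set_def)
  have mono: "strict_mono_on {1..\<zeta> j} (\<lambda>i. Y (j, i))" if "j \<in> {1..lam 1}" for j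
    by (rule strict_mono_onI) (use that in \<open>auto simp: boxes_iff intro!: strict\<close>)
  have card: "card (?C j) = \<zeta> j" if "j \<in> {1..lam 1}" for j
    unfolding C using strict_mono_on_imp_inj_on[OF mono[OF that]] by (simp add: card_image)
  have fin: "finite (?C j)" for j unfolding C by simp
  have sub: "?C j \<subseteq> {1..n}" if "j \<in> {1..lam 1}" for j
    unfolding C using T that by (force simp: PiE_iff boxes_iff)
  have same: "?C j = ?C l" if "j \<in> {1..lam 1}" "l \<in> {1..lam 1}" "\<zeta> j = \<zeta> l" for j l
    using that nested[of j l] nested[of l j] card[of j] card[of l] fin
    by (metis card_subset_eq linear)
  have index_cases: thesis
    if "h \<le> Suc r" "h = 0 \<Longrightarrow> thesis" "h = Suc r \<Longrightarrow> thesis"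
      "\<And>k. h = Suc k \<Longrightarrow> Suc k \<le> r \<Longrightarrow> thesis" for h thesis
    using that by (cases h) (auto simp: le_Suc_eq)
  \<comment> \<open>\<open>lam (q h)\<close> is the rightmost column of length \<open>q h\<close>.
    The last set is put in by hand because there may be no column of length n.\<close>
  define B where "B h = (if h = 0 then {} else if h \<le> r then ?C (lam (q h))
    else if h = Suc r then {1..n} else undefined)" for h
  have B: "B (Suc h) = ?C (lam (q (Suc h)))" if "Suc h \<le> r" for h using that by (simp add: B_def)
  have cards: "card (B h) = q h" if "h \<le> Suc r" for h
    using that
  proof (rule index_cases)
    fix k assume "h = Suc k" "Suc k \<le> r"
    then show ?thesis using card[OF row_end_column] B col_len_lam_q[of k] by simp
  qed (auto simp: B_def)
  have subs: "B h \<subseteq> {1..n}" if "h \<le> Suc r" for h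
    using that
  proof (rule index_cases)
    fix k assume "h = Suc k" "Suc k \<le> r"
    then show ?thesis using sub[OF row_end_column] B by simp
  qed (auto simp: B_def)
  have "B h \<subseteq> B (Suc h)" if "h \<le> r" for h
  proof (cases "h = r")
    case True
    then show ?thesis using subs[of r] by (simp add: B_def)
  next
    case False
    then have r: "Suc h \<le> r" using that by simp
    show ?thesis
    proof (cases h)
      case 0
      then show ?thesis by (simp add: B_def)
    next
      case (Suc k)
      then have "?C (lam (q (Suc k))) \<subseteq> ?C (lam (q (Suc (Suc k))))"
        using r row_end_column[of k] row_end_column[of "Suc k"] lam_q_antimono[of k "Suc k"]
        by (intro nested) auto
      then show ?thesis using B[of k] B[of "Suc k"] Suc r by simp
    qed
  qed
  then have psub: "B h \<subset> B (Suc h)" if "h \<le> r" for h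
    using that cards[of h] cards[of "Suc h"] q_less[of h "Suc h"] by fastforce
  have chain: "B \<in> R_chains n R" unfolding R_chains_def
  proof (intro CollectI conjI)
    show "B \<in> {0..r + 1} \<rightarrow>\<^sub>E Pow {1..n}"
      using subs by (intro PiE_I) (auto simp: B_def)
  qed (use psub cards in \<open>auto simp: B_def\<close>)
  have "portrayal n lam B x = Y x" for x
  proof (cases "x \<in> boxes n lam")
    case True
    then obtain j i where x: "x = (j, i)" "(j, i) \<in> boxes n lam" by (cases x) auto
    then have j: "j \<in> {1..lam 1}" "1 \<le> i" "i \<le> \<zeta> j" by (auto simp: boxes_iff)
    obtain h where h: "h \<le> r" "\<zeta> j = q (Suc h)" using col_len_cases[OF j(1)] by blast
    have "B (Suc h) = ?C j"
    proof (cases "h = r")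
      case True
      then have "?C j = {1..n}" using sub[OF j(1)] card[OF j(1)] h by (intro card_subset_eq) auto
      then show ?thesis using True by (simp add: B_def)
    next
      case False
      then show ?thesis
        using B[of h] same[OF j(1) row_end_column[of h]] col_len_lam_q[of h] h by simp
    qed
    then have "portrayal n lam B x = kth_least (?C j) i"
      using portrayal_apply[OF chain x(2) h(2,1)] x by simp
    also have "\<dots> = Y x" unfolding C x(1) using kth_least_image[OF mono[OF j(1)]] j by simp
    finally show ?thesis .
  next
    case False
    then show ?thesis using T by (simp add: portrayal_def PiE_arb[OF T])
  qed
  then show ?thesis using that[OF chain] by blast
qed

section \<open>The portrayal as the maximal tableau with its row ends\<close>

lemma portrayal_row_ends:
  assumes B: "B \<in> R_chains n R"
  shows "portrayal n lam B \<in> tableaux_with_row_ends n lam (chain_tuple n R B)"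
proof -
  have "portrayal n lam B (lam i, i) = chain_tuple n R B i" if i: "i \<in> {1..n}" "1 \<le> lam i" for i
  proof -
    obtain h where h: "h \<le> r" "i \<in> carrel n R (Suc h)" using carrel_cover[OF i(1)] by blast
    have len: "\<zeta> (lam i) = q (Suc h)" using lam_carrel[OF h] col_len_lam_q[OF h(1)] by simp
    have "(lam i, i) \<in> boxes n lam"
      using i lam_le_lam_1[of i] len h by (auto simp: boxes_iff carrel_Suc)
    then show ?thesis using portrayal_apply[OF B _ len h(1)] chain_tuple_eq[OF h] by simp
  qed
  then show ?thesis using portrayal_in_lam_keys[OF B]
    by (simp add: tableaux_with_row_ends_def lam_keys_def)
qed

lemma tableau_column_gap:
  assumes T: "T \<in> tableaux n lam" and "j \<in> {1..lam 1}" "1 \<le> i" "i + t \<le> \<zeta> j"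
  shows "T (j, i) + t \<le> T (j, i + t)"
  using assms(4)
proof (induction t)
  case (Suc t)
  then have "T (j, i + t) < T (j, i + Suc t)" using T assms(2,3)
    by (auto simp: tableaux_def boxes_iff)
  then show ?case using Suc by simp
qed simp

text \<open>Induction from the shortest columns to longer ones. In the rows of the last carrel of a
  column the row end itself is the bound; in higher rows the bounds from the right and from below
  are combined by \<open>le_kth_least_gapless\<close>.\<close>

lemma row_ends_le_portrayal:
  assumes G: "B \<in> gapless_chains n R"
    and T: "T \<in> tableaux_with_row_ends n lam (chain_tuple n R B)"
    and box: "(j, i) \<in> boxes n lam" and h: "\<zeta> j = q (Suc h)" "h \<le> r"
  shows "T (j, i) \<le> kth_least (B (Suc h)) i"
  using box h
proof (induction h arbitrary: j i)
  have tab: "T \<in> tableaux n lam"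
    and ends: "\<And>i. i \<in> {1..n} \<Longrightarrow> 1 \<le> lam i \<Longrightarrow> T (lam i, i) = chain_tuple n R B i"
    using T by (auto simp: tableaux_with_row_ends_def)
  have rows: "T (j, i) \<le> T (l, i)"
    if "(j, i) \<in> boxes n lam" "(l, i) \<in> boxes n lam" "j \<le> l" for j l i
    using tab that by (simp add: tableaux_def)
  have last_carrel: "T (j, i) \<le> kth_least (B (Suc h)) i"
    if box: "(j, i) \<in> boxes n lam" and h: "\<zeta> j = q (Suc h)" "h \<le> r" and "q h < i" for j i h
  proof -
    have i: "i \<in> carrel n R (Suc h)" using that by (auto simp: carrel_Suc boxes_iff)
    note bounds = carrel_bounds[OF h(2) i]
    have j: "j \<le> lam i" "1 \<le> j"
      using box bounds le_col_len_iff[of i j] by (auto simp: boxes_iff)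
    have "(lam i, i) \<in> boxes n lam"
      using j bounds lam_le_lam_1[of i] le_col_len_iff[of i "lam i"] by (auto simp: boxes_iff)
    then have "T (j, i) \<le> T (lam i, i)" using rows[OF box] j by blast
    also have "\<dots> = kth_least (B (Suc h)) i"
      using ends[of i] bounds j chain_tuple_eq[OF h(2) i] by simp
    finally show ?thesis .
  qed
  {
    case 0
    then show ?case using last_carrel[of j i 0] by (simp add: boxes_iff)
  next
    case (Suc h)
    let ?B = "B (Suc h)" and ?B' = "B (Suc (Suc h))" and ?q = "q (Suc h)" and ?l = "lam (q (Suc h))"
    show ?case
    proof (cases "?q < i")
      case True
      then show ?thesis using last_carrel Suc.prems by blast
    next
      case False
      have hr: "Suc h \<le> r" "h \<le> r" using Suc.prems by auto
      have i: "1 \<le> i" "i \<le> ?q" and j: "j \<in> {1..lam 1}" using False Suc.prems by (auto simp: boxes_iff)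
      have B: "B \<in> R_chains n R" using G by (simp add: gapless_chains_def)
      have card: "card ?B = ?q" using chain_card[OF B, of "Suc h"] hr by simp
      have less: "?q < \<zeta> j" using q_less[of "Suc h" "Suc (Suc h)"] Suc.prems by simp
      have "?l \<in> {1..lam 1}" using row_end_column hr by blast
      then have lbox: "(?l, i) \<in> boxes n lam" using col_len_lam_q[OF hr(2)] i by (simp add: boxes_iff)
      have "j \<le> ?l" using le_col_len_iff[of ?q j] q_Suc_bounds[OF hr(2)] less by simp
      then have "T (j, i) \<le> T (?l, i)" using rows[OF Suc.prems(1) lbox] by blast
      also have "\<dots> \<le> kth_least ?B i" using Suc.IH[OF lbox] col_len_lam_q hr by blast
      finally have right: "T (j, i) \<le> kth_least ?B i" .
      \<comment> \<open>Strict increase down the column costs at least one per row from row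
        \<open>i\<close> to row \<open>?q + 1\<close>, the first row of the last carrel of this
        column.\<close>
      have "i + (?q + 1 - i) = ?q + 1" using i by simp
      then have "T (j, i) + (?q + 1 - i) \<le> T (j, ?q + 1)"
        using tableau_column_gap[OF tab j i(1), of "?q + 1 - i"] less by simp
      also have "\<dots> \<le> kth_least ?B' (?q + 1)"
        using Suc.prems j less by (intro last_carrel) (auto simp: boxes_iff)
      finally have below: "T (j, i) + (?q + 1 - i) \<le> kth_least ?B' (?q + 1)" .
      show ?thesis
        using le_kth_least_gapless[OF chain_finite[OF B] chain_psubset[OF B]
            gapless_chains_stepD[OF G], of "Suc h" i "T (j, i)"] right below card i hr by simp
    qed
  }
qed

text \<open>The portrayal has the prescribed row ends and bounds every tableau that has them, so
  each entrywise maximum is attained by it. The bound also makes the sets of entries finite, as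
  \<open>Max\<close> requires.\<close>

lemma row_end_max_chain_tuple:
  assumes G: "B \<in> gapless_chains n R"
  shows "row_end_max n lam (chain_tuple n R B) = portrayal n lam B"
proof
  fix x
  let ?S = "tableaux_with_row_ends n lam (chain_tuple n R B)"
  have B: "B \<in> R_chains n R" using G by (simp add: gapless_chains_def)
  show "row_end_max n lam (chain_tuple n R B) x = portrayal n lam B x"
  proof (cases "x \<in> boxes n lam")
    case True
    then obtain j i where x: "x = (j, i)" "(j, i) \<in> boxes n lam" by (cases x) auto
    then have "j \<in> {1..lam 1}" by (simp add: boxes_iff)
    then obtain h where h: "h \<le> r" "\<zeta> j = q (Suc h)" using col_len_cases by blast
    have le: "T x \<le> portrayal n lam B x" if "T \<in> ?S" for T
      using row_ends_le_portrayal[OF G that x(2) h(2,1)] portrayal_apply[OF B x(2) h(2,1)] x by simp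
    have "Max {T x | T. T \<in> ?S} = portrayal n lam B x"
    proof (rule Max_eqI)
      show "finite {T x | T. T \<in> ?S}"
        by (rule finite_subset[of _ "{..portrayal n lam B x}"]) (use le in auto)
    qed (use le portrayal_row_ends[OF B] in auto)
    then show ?thesis using True by (simp add: row_end_max_def)
  next
    case False
    then show ?thesis by (simp add: row_end_max_def portrayal_def)
  qed
qed

end

theorem theorem9p2:
  fixes n :: nat and lam :: "nat \<Rightarrow> nat" and R :: "nat set"
    and A C :: "(nat \<Rightarrow> nat) set" and B :: "(nat \<Rightarrow> nat set) set"
    and P_lam Q_lam R_lam :: "(nat \<times> nat \<Rightarrow> nat) set"
  assumes "n \<ge> 1" and "is_partition n lam"
    and "R = R_of n lam"
    and "A = R_312_avoiding_perms n R"
    and "P_lam = key_of n lam ` A"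
    and "B = rightmost_clump_deleting_chains n R"
    and "Q_lam = gapless_keys n lam"
    and "C = UG n R"
    and "R_lam = row_end_max n lam ` C"
  shows
    "(bij_betw (portrayal n lam) B Q_lam \<and>
      bij_betw (row_end_max n lam) C R_lam) \<and>
     (P_lam = Q_lam \<and>
      induces (perm_chain n R) A B (key_of n lam) P_lam (portrayal n lam) Q_lam id \<and>
      (\<forall>\<pi>\<in>R_perms n R. \<not> R_312_containing n R \<pi> \<longleftrightarrow> key_of n lam \<pi> \<in> gapless_keys n lam)) \<and>
     ((\<forall>\<pi>\<in>R_perms n R. \<not> R_312_containing n R \<pi> \<longrightarrow>
         row_end_max n lam (Psi n R \<pi>) = key_of n lam \<pi>) \<and>
      P_lam = R_lam \<and>
      induces (Psi n R) A C (key_of n lam) P_lam (row_end_max n lam) R_lam id)"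
proof -
  interpret partition_shape n lam using assms(1,2) by unfold_locales
  note R = assms(3)
  have B: "B = gapless_chains n R"
    using assms(6) rightmost_clump_deleting_chains_eq R by simp
  have sub: "B \<subseteq> R_chains n R" by (auto simp: B gapless_chains_def)
  have key: "key_of n lam \<pi> = portrayal n lam (perm_chain n R \<pi>)" for \<pi>
    by (simp add: key_of_def R)
  \<comment> \<open>312-avoiding permutations are the preimage of the gapless chains under
    \<open>perm_chain\<close>, so surjectivity onto all chains restricts to \<open>A\<close> and
    \<open>B\<close>.\<close>
  have A: "\<pi> \<in> A \<longleftrightarrow> \<pi> \<in> R_perms n R \<and> perm_chain n R \<pi> \<in> B" for \<pi>
    using perm_chain_312_iff assms(4) R B by (auto simp: R_312_avoiding_perms_def)
  have image_A: "perm_chain n R ` A = B"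
  proof
    show "perm_chain n R ` A \<subseteq> B" using A by blast
    show "B \<subseteq> perm_chain n R ` A"
    proof
      fix b assume "b \<in> B"
      then obtain \<pi> where "\<pi> \<in> R_perms n R" "perm_chain n R \<pi> = b"
        using perm_chain_surj[of b] sub R by blast
      then show "b \<in> perm_chain n R ` A" using A \<open>b \<in> B\<close> by blast
    qed
  qed
  have inj: "inj_on (portrayal n lam) B"
    using portrayal_inj sub R by (blast intro: inj_on_subset)
  have image_B: "portrayal n lam ` B = Q_lam"
  proof
    show "portrayal n lam ` B \<subseteq> Q_lam" using portrayal_gapless_iff sub B R assms(7) by blast
    show "Q_lam \<subseteq> portrayal n lam ` B"
    proof
      fix Y assume Y: "Y \<in> Q_lam"
      then have "Y \<in> lam_keys n lam" using assms(7) by (simp add: gapless_keys_def)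
      then obtain b where "b \<in> R_chains n R" "portrayal n lam b = Y"
        using portrayal_surj R by blast
      then show "Y \<in> portrayal n lam ` B" using Y portrayal_gapless_iff B R assms(7) by blast
    qed
  qed
  have row_end_max: "row_end_max n lam (chain_tuple n R b) = portrayal n lam b" if "b \<in> B" for b
    using row_end_max_chain_tuple that B R by simp
  have C: "C = chain_tuple n R ` B"
  proof
    show "C \<subseteq> chain_tuple n R ` B" using chain_tuple_surj assms(8) B R by blast
    show "chain_tuple n R ` B \<subseteq> C" using chain_tuple_in_UG assms(8) B R by blast
  qed
  \<comment> \<open>On \<open>C\<close>, which is the image of \<open>B\<close> under
    \<open>chain_tuple\<close>, \<open>row_end_max\<close> returns the portrayal of the underlying
    chain. Equal maxima thus come from equal chains, hence from equal tuples.\<close>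
  have inj_C: "inj_on (row_end_max n lam) C"
    unfolding C using inj row_end_max by (auto simp: inj_on_def)
  have R_lam: "R_lam = Q_lam" unfolding assms(9) C image_B[symmetric] image_image
    using row_end_max by (intro image_cong) auto
  have P_lam: "P_lam = Q_lam"
    unfolding assms(5) image_B[symmetric] image_A[symmetric] image_image key ..
  have Psi: "Psi n R \<pi> = chain_tuple n R (perm_chain n R \<pi>)" if "\<pi> \<in> R_perms n R" for \<pi>
    using Psi_eq_chain_tuple that R by simp
  have max_Psi: "row_end_max n lam (Psi n R \<pi>) = key_of n lam \<pi>" if "\<pi> \<in> A" for \<pi>
    using that A Psi row_end_max key by simp
  have "bij_betw (portrayal n lam) B Q_lam" "bij_betw (row_end_max n lam) C R_lam"
    using inj image_B inj_C assms(9) by (auto simp: bij_betw_def)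
  moreover have "induces (perm_chain n R) A B (key_of n lam) P_lam (portrayal n lam) Q_lam id"
    unfolding induces_def using image_A image_B P_lam assms(5) key by auto
  moreover have "\<not> R_312_containing n R \<pi> \<longleftrightarrow> key_of n lam \<pi> \<in> gapless_keys n lam"
    if "\<pi> \<in> R_perms n R" for \<pi>
    using that perm_chain_312_iff portrayal_gapless_iff perm_chain_in_R_chains key R by simp
  moreover have "row_end_max n lam (Psi n R \<pi>) = key_of n lam \<pi>"
    if "\<pi> \<in> R_perms n R" "\<not> R_312_containing n R \<pi>" for \<pi>
    using that max_Psi assms(4) by (simp add: R_312_avoiding_perms_def)
  moreover have "induces (Psi n R) A C (key_of n lam) P_lam (row_end_max n lam) R_lam id"
    unfolding induces_def using A C Psi max_Psi P_lam R_lam assms(5,9) by auto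
  ultimately show ?thesis using P_lam R_lam by blast
qed

end
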